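(* Let $\Phi(x)=x\psi'(x)-1$ for $x>0$. There exists $m_0\in\mathbb{N}$ such that for every integer $m\geq m_0$ and every $\alpha\in\{m,m-1\}$, the function $x\mapsto(-1)^m x^{\alpha}\Phi^{(m)}(x)$ is not completely monotonic on $(0,+\infty)$.
   Context: $\psi=\Gamma'/\Gamma$ is the digamma function on $(0,+\infty)$, where $\Gamma(x)=\int_0^\infty t^{x-1}e^{-t}\,dt$ is Euler's gamma function; $\Phi^{(m)}$ denotes the $m$-th derivative of $\Phi$. $\mathbb{N}=\{1,2,3,\dots\}$. A function $f$ is completely monotonic on an interval $I$ if it has derivatives of all orders on $I$ and $(-1)^n f^{(n)}(x)\geq 0$ for all $x\in I$ and all integers $n\geq 0$. *)

theory Defs
  imports "HOL-Analysis.Analysis"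
begin

(* F n plays the role of the n-th derivative of f on I; derivatives are taken relative to I, hence
   one-sided at endpoints belonging to I. On an interval with more than one point, F is uniquely
   determined on I. *)
definition completely_monotonic_on :: "real set \<Rightarrow> (real \<Rightarrow> real) \<Rightarrow> bool" where
  "completely_monotonic_on I f \<longleftrightarrow>
     (\<exists>F :: nat \<Rightarrow> real \<Rightarrow> real.
        (\<forall>x\<in>I. F 0 x = f x) \<and>
        (\<forall>n. \<forall>x\<in>I. (F n has_real_derivative F (Suc n) x) (at x within I)) \<and>
        (\<forall>n. \<forall>x\<in>I. 0 \<le> (-1) ^ n * F n x))"

lemma completely_monotonic_on_open_iff:
  assumes "open I"
  shows "completely_monotonic_on I f \<longleftrightarrow>
     (\<forall>n. \<forall>x\<in>I. (deriv ^^ n) f differentiable at x \<and> 0 \<le> (-1) ^ n * (deriv ^^ n) f x)"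
proof
  assume "completely_monotonic_on I f"
  then obtain F where F0: "\<And>x. x \<in> I \<Longrightarrow> F 0 x = f x"
    and FS: "\<And>n x. x \<in> I \<Longrightarrow> (F n has_real_derivative F (Suc n) x) (at x within I)"
    and nonneg: "\<And>n x. x \<in> I \<Longrightarrow> 0 \<le> (-1) ^ n * F n x"
    unfolding completely_monotonic_on_def by blast
  have step: "((deriv ^^ n) f has_real_derivative F (Suc n) x) (at x)"
    if eq: "\<And>x. x \<in> I \<Longrightarrow> (deriv ^^ n) f x = F n x" and x: "x \<in> I" for n x
  proof -
    have "(F n has_real_derivative F (Suc n) x) (at x)"
      using FS[OF x] at_within_open[OF x assms] by simp
    then show ?thesis
      using has_field_derivative_transform_within_open[OF _ assms x] eq by metis
  qed
  have eq: "(deriv ^^ n) f x = F n x" if "x \<in> I" for n x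
    using that
  proof (induction n arbitrary: x)
    case 0
    then show ?case using F0 by simp
  next
    case (Suc n)
    then show ?case using step[of n x] by (simp add: DERIV_imp_deriv)
  qed
  show "\<forall>n. \<forall>x\<in>I. (deriv ^^ n) f differentiable at x \<and> 0 \<le> (-1) ^ n * (deriv ^^ n) f x"
    using step eq nonneg by (metis real_differentiable_def)
next
  assume *: "\<forall>n. \<forall>x\<in>I. (deriv ^^ n) f differentiable at x \<and> 0 \<le> (-1) ^ n * (deriv ^^ n) f x"
  have "((deriv ^^ n) f has_real_derivative (deriv ^^ Suc n) f x) (at x within I)"
    if "x \<in> I" for n x
  proof -
    have "(deriv ^^ n) f field_differentiable at x"
      using * that by (auto simp: real_differentiable_def field_differentiable_def)
    then show ?thesis
      by (simp add: field_differentiable_derivI has_field_derivative_at_within)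
  qed
  with * show "completely_monotonic_on I f"
    unfolding completely_monotonic_on_def by (intro exI[of _ "\<lambda>n. (deriv ^^ n) f"]) auto
qed

lemma Digamma_eq_deriv_Gamma_over_Gamma:
  fixes x :: real
  assumes "0 < x"
  shows "Digamma x = deriv Gamma x / Gamma x"
proof -
  have nonpos: "x \<notin> \<int>\<^sub>\<le>\<^sub>0"
    using assms by (auto elim!: nonpos_Ints_cases)
  then have "deriv Gamma x = Gamma x * Digamma x"
    by (intro DERIV_imp_deriv has_field_derivative_Gamma)
  moreover have "Gamma x \<noteq> 0"
    using nonpos by (simp add: Gamma_eq_zero_iff)
  ultimately show ?thesis by simp
qed

(* Only the values for x > 0 matter. *)
definition Phi :: "real \<Rightarrow> real" where
  "Phi x = x * deriv Digamma x - 1"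

end

theory Submission
  imports Defs "HOL-Number_Theory.Number_Theory" "HOL-Probability.Sinc_Integral"
begin

text \<open>
  Write $\Phi(x) = \int_0^\infty F(w)\,\kappa(xw)\,dw$ with $\kappa(y) = \int_0^\infty e^{-s-y/s}\,ds$ and
  $F(w) = \frac12 + \frac1\pi f(\frac{w}{2\pi})$, where $f(u) = \sum_{n\ge1} \frac1n \sin\frac un$ is the
  Hardy--Littlewood function: $F$ is the Borel transform of $t/(1-e^{-t})-1$, whose partial fraction
  expansion produces the sines. The substitution $s \mapsto y\sigma$ turns $y^{m-1}(-1)^m\kappa^{(m)}(y)$ into
  $\int_0^\infty \sigma^{-m}e^{-y\sigma-1/\sigma}\,d\sigma$, so $m$ further derivatives give
  \[ (-1)^m \frac{d^m}{dx^m}\bigl(x^{m-1}(-1)^m\Phi^{(m)}(x)\bigr)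
     = \frac1x \int_0^\infty F(w)\,w^m\kappa(xw)\,dw, \]
  and for large $m$ the weight $w^m\kappa(xw)$ concentrates at any prescribed point. Hence it suffices that
  $F$ takes a negative value, i.e. that $f(u) < -\pi/2$ for some $u$. If $N$ is a product of primes
  congruent to 1 mod 4, the average of $f$ over $u = 2\pi(\frac{3N+1}4 + Nk)$ is
  $-\sum_{n\mid N} \frac1n\cos\frac\pi{2n} + O(1)$, because every divisor $n$ of $N$ is 1 mod 4; these
  divisor sums are unbounded, since $\sum_{n\le x} \frac1n \sum_{d\mid n} \chi_4(d)$ over odd $n$ diverges
  and $\sum_{d\mid n} \chi_4(d)$ vanishes unless $n$ is a square times a product of such primes.
\<close>

section \<open>Divisor sums over primes congruent to 1 mod 4\<close>

text \<open>The non-principal Dirichlet character modulo 4.\<close>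

definition chi4 :: "nat \<Rightarrow> real" where
  "chi4 n = (if n mod 4 = 1 then 1 else if n mod 4 = 3 then -1 else 0)"

text \<open>The Dirichlet convolution of \<open>chi4\<close> with 1; for positive \<open>n\<close>
  the number \<open>4 * sum_chi4 n\<close> counts the representations of \<open>n\<close> as a sum
  of two squares.\<close>

definition sum_chi4 :: "nat \<Rightarrow> real" where
  "sum_chi4 n = (\<Sum>d | d dvd n. chi4 d)"

definition smooth1mod4 :: "nat set" where
  "smooth1mod4 = {n. 0 < n \<and> (\<forall>p. prime p \<longrightarrow> p dvd n \<longrightarrow> p mod 4 = 1)}"

lemma chi4_mult: "chi4 (a * b) = chi4 a * chi4 b"
proof -
  have "a mod 4 < 4" "b mod 4 < 4" by simp_all
  then have "a mod 4 \<in> {0,1,2,3}" "b mod 4 \<in> {0,1,2,3}" by auto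
  moreover have "(a * b) mod 4 = ((a mod 4) * (b mod 4)) mod 4"
    by (simp add: mod_mult_eq)
  ultimately show ?thesis
    unfolding chi4_def by auto
qed

lemma chi4_one [simp]: "chi4 (Suc 0) = 1"
  by (simp add: chi4_def)

lemma chi4_power: "chi4 (a ^ k) = chi4 a ^ k"
  by (induction k) (simp_all add: chi4_mult)

lemma chi4_even: "even n \<Longrightarrow> chi4 n = 0"
proof -
  assume "even n"
  then have "n mod 4 \<noteq> 1" "n mod 4 \<noteq> 3" by presburger+
  then show ?thesis by (simp add: chi4_def)
qed

text \<open>Every divisor of \<open>p ^ k * m\<close> is \<open>p ^ i * d\<close> for exactly one
  pair with \<open>i \<le> k\<close> and \<open>d dvd m\<close>; since \<open>chi4\<close> is
  completely multiplicative, the sum over pairs factors.\<close>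

lemma sum_chi4_prime_power_mult:
  assumes p: "prime p" and m: "0 < m" "\<not> p dvd m"
  shows "sum_chi4 (p ^ k * m) = (\<Sum>i\<le>k. chi4 p ^ i) * sum_chi4 m"
proof -
  let ?D = "{..k} \<times> {d. d dvd m}"
  let ?h = "\<lambda>(i, d). p ^ i * d"
  have p0: "p \<noteq> 0" using p by auto
  have inj: "inj_on ?h ?D"
  proof (rule inj_onI, clarsimp)
    fix i d j e
    assume "d dvd m" "e dvd m" and eq: "p ^ i * d = p ^ j * e"
    then have nd: "\<not> p dvd d" "\<not> p dvd e"
      using m by (meson dvd_trans)+
    have "i = j"
    proof (rule ccontr)
      assume "i \<noteq> j"
      \<comment> \<open>Cancelling the smaller power of \<open>p\<close> leaves a factor
        \<open>p\<close> in the cofactor on that side, which divides \<open>m\<close>.\<close>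
      have aux: "p dvd b" if "i < j" "p ^ i * b = p ^ j * c" for i j b c
      proof -
        have "p ^ j = p ^ i * (p * p ^ (j - i - 1))"
          using that(1) by (metis Suc_diff_1 Suc_leI add_diff_inverse_nat diff_is_0_eq less_imp_not_less linorder_not_le power_Suc power_add zero_less_diff)
        then have "b = p * p ^ (j - i - 1) * c" using that(2) p0 by simp
        then show ?thesis by simp
      qed
      show False
        using aux[of i j d e] aux[of j i e d] nd eq \<open>i \<noteq> j\<close> by (metis linorder_neqE_nat)
    qed
    then show "i = j \<and> d = e" using eq p0 by simp
  qed
  have img: "{d. d dvd p ^ k * m} = ?h ` ?D"
  proof (intro equalityI subsetI)
    fix d assume "d \<in> {d. d dvd p ^ k * m}"
    then obtain b c where "d = b * c" "b dvd p ^ k" "c dvd m"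
      using division_decomp by blast
    moreover then obtain i where "i \<le> k" "b = p ^ i"
      using divides_primepow_nat[OF p] by blast
    ultimately show "d \<in> ?h ` ?D" by force
  next
    fix d assume "d \<in> ?h ` ?D"
    then show "d \<in> {d. d dvd p ^ k * m}"
      by (auto intro!: mult_dvd_mono le_imp_power_dvd)
  qed
  have "sum_chi4 (p ^ k * m) = (\<Sum>z\<in>?D. chi4 (?h z))"
    unfolding sum_chi4_def img by (simp add: sum.reindex[OF inj])
  also have "\<dots> = (\<Sum>i\<le>k. \<Sum>d | d dvd m. chi4 p ^ i * chi4 d)"
    by (simp add: sum.cartesian_product chi4_mult chi4_power case_prod_beta)
  also have "\<dots> = (\<Sum>i\<le>k. chi4 p ^ i) * sum_chi4 m"
    by (simp add: sum_chi4_def sum_product)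
  finally show ?thesis .
qed

lemma smooth1mod4_mult: "a \<in> smooth1mod4 \<Longrightarrow> b \<in> smooth1mod4 \<Longrightarrow> a * b \<in> smooth1mod4"
  by (auto simp: smooth1mod4_def prime_dvd_mult_iff)

lemma one_in_smooth1mod4 [simp]: "Suc 0 \<in> smooth1mod4"
  by (auto simp: smooth1mod4_def)

lemma prod_in_smooth1mod4: "(\<And>x. x \<in> A \<Longrightarrow> x \<in> smooth1mod4) \<Longrightarrow> \<Prod>A \<in> smooth1mod4"
  by (induction A rule: infinite_finite_induct) (auto intro: smooth1mod4_mult)

lemma dvd_in_smooth1mod4: "b \<in> smooth1mod4 \<Longrightarrow> a dvd b \<Longrightarrow> a \<in> smooth1mod4"
  unfolding smooth1mod4_def by (auto intro: dvd_trans dvd_pos_nat)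

lemma prime_power_in_smooth1mod4: "prime p \<Longrightarrow> p mod 4 = 1 \<Longrightarrow> p ^ k \<in> smooth1mod4"
  by (auto simp: smooth1mod4_def prime_gt_0_nat dest: prime_dvd_power primes_dvd_imp_eq)

lemma smooth1mod4_mod4: "n \<in> smooth1mod4 \<Longrightarrow> n mod 4 = 1"
proof (induction n rule: less_induct)
  case (less n)
  show ?case
  proof (cases "n = 1")
    case False
    then obtain p where p: "prime p" "p dvd n" by (metis prime_factor_nat)
    then obtain q where q: "n = p * q" by auto
    have "0 < n" "p mod 4 = 1" using less.prems p by (auto simp: smooth1mod4_def)
    moreover have "q < n" using q \<open>0 < n\<close> prime_gt_1_nat[OF p(1)] by auto
    moreover have "q \<in> smooth1mod4" using less.prems q dvd_in_smooth1mod4 by simp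
    ultimately show ?thesis
      using less.IH[of q] q by (metis mod_mult_eq mult_1 mod_mult_left_eq)
  qed simp
qed

lemma sum_chi4_smooth1mod4: "s \<in> smooth1mod4 \<Longrightarrow> sum_chi4 s = real (card {d. d dvd s})"
  unfolding sum_chi4_def using dvd_in_smooth1mod4 smooth1mod4_mod4
  by (simp add: chi4_def)

text \<open>Strong induction that strips one prime with its full power \<open>p ^ k\<close>. If
  \<open>p\<close> is 1 mod 4, the power joins \<open>s\<close>. If \<open>p\<close> is 3 mod 4, its
  factor is an alternating geometric sum: it is 1 for even \<open>k\<close>, when the power joins
  the square part, and 0 for odd \<open>k\<close>, when the whole sum vanishes.\<close>

lemma sum_chi4_cases:
  assumes "odd n"
  shows "sum_chi4 n = 0 \<or> (\<exists>s t. s \<in> smooth1mod4 \<and> n = s * t ^ 2 \<and> sum_chi4 n = sum_chi4 s)"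
  using assms
proof (induction n rule: less_induct)
  case (less n)
  show ?case
  proof (cases "n = 1")
    case True
    then show ?thesis by (intro disjI2 exI[of _ 1]) auto
  next
    case False
    have n0: "0 < n" using less.prems by (auto intro: odd_pos)
    obtain p where p: "prime p" "p dvd n" using False by (metis prime_factor_nat)
    obtain k m where km: "\<not> p dvd m" "n = m * p ^ k"
      using prime_power_canonical[OF p(1) n0] by blast
    have k0: "0 < k" using km p by (cases k) auto
    have m0: "0 < m" using n0 km by simp
    have "1 < p ^ k" using k0 prime_gt_1_nat[OF p(1)] by (rule one_less_power[rotated])
    then have mn: "m < n" using m0 km(2) by simp
    have "odd m" "odd p" using less.prems km k0 by auto
    then have IH: "sum_chi4 m = 0 \<or>
        (\<exists>s t. s \<in> smooth1mod4 \<and> m = s * t ^ 2 \<and> sum_chi4 m = sum_chi4 s)"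
      using less.IH[OF mn] by simp
    have rn: "sum_chi4 n = (\<Sum>i\<le>k. chi4 p ^ i) * sum_chi4 m"
      using sum_chi4_prime_power_mult[OF p(1) m0 km(1), of k] km(2) by (simp add: mult.commute)
    show ?thesis
    proof (cases "sum_chi4 m = 0")
      case True
      then show ?thesis using rn by simp
    next
      case nz: False
      then obtain s t where st: "s \<in> smooth1mod4" "m = s * t ^ 2" "sum_chi4 m = sum_chi4 s"
        using IH by blast
      have "p mod 4 = 1 \<or> p mod 4 = 3" using \<open>odd p\<close> by presburger
      then show ?thesis
      proof
        assume p1: "p mod 4 = 1"
        \<comment> \<open>As \<open>s\<close> divides \<open>m\<close>, the prime \<open>p\<close>
          is new to \<open>s\<close> as well, so passing from \<open>s\<close> to
          \<open>p ^ k * s\<close> multiplies the divisor sum by the same factor as passing from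
          \<open>m\<close> to \<open>n\<close>.\<close>
        have "0 < s" "\<not> p dvd s" using st(1,2) km(1) by (auto simp: smooth1mod4_def)
        then have "sum_chi4 (p ^ k * s) = sum_chi4 n"
          using sum_chi4_prime_power_mult[OF p(1), of s k] rn st(3) by simp
        moreover have "p ^ k * s \<in> smooth1mod4"
          by (intro smooth1mod4_mult prime_power_in_smooth1mod4 p p1 st)
        moreover have "n = p ^ k * s * t ^ 2" using km(2) st(2) by simp
        ultimately show ?thesis by metis
      next
        assume p3: "p mod 4 = 3"
        then have c: "chi4 p = -1" by (simp add: chi4_def)
        have gs: "(\<Sum>i\<le>k. (-1::real) ^ i) = (if even k then 1 else 0)"
          by (induction k) auto
        show ?thesis
        proof (cases "even k")
          case True
          then obtain j where j: "k = 2 * j" by auto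
          have "n = s * (p ^ j * t) ^ 2"
            using km(2) st(2) j by (simp add: power_mult_distrib power_mult mult_ac power2_eq_square)
          moreover have "sum_chi4 n = sum_chi4 s" using rn c gs True st(3) by simp
          ultimately show ?thesis using st(1) by metis
        next
          case False
          then show ?thesis using rn c gs by simp
        qed
      qed
    qed
  qed
qed

text \<open>These are the partial sums of 1 - 1/3 + 1/5 - ..., an alternating series with decreasing
  terms. Their smallest value is 1 - 1/3, taken at \<open>y = 3\<close>; the induction runs over
  blocks of four.\<close>

lemma sum_chi4_over_ge:
  assumes "1 \<le> y"
  shows "2 / 3 \<le> (\<Sum>d=1..y. chi4 d / d)"
proof -
  let ?T = "\<lambda>y. \<Sum>d=1..y. chi4 d / real d"
  have step: "?T (4 * j + 1) = ?T (4 * j) + 1 / real (4 * j + 1)" "?T (4 * j + 2) = ?T (4 * j + 1)"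
    "?T (4 * j + 3) = ?T (4 * j + 2) - 1 / real (4 * j + 3)" "?T (4 * j + 4) = ?T (4 * j + 3)" for j
  proof -
    have e: "4 * j + 1 = Suc (4 * j)" "4 * j + 2 = Suc (4 * j + 1)"
      "4 * j + 3 = Suc (4 * j + 2)" "4 * j + 4 = Suc (4 * j + 3)" by simp_all
    have m: "(4 * j + 1) mod 4 = 1" "(4 * j + 2) mod 4 = 2" "(4 * j + 3) mod 4 = 3" "(4 * j + 4) mod 4 = 0"
      by presburger+
    show "?T (4 * j + 1) = ?T (4 * j) + 1 / real (4 * j + 1)"
      using m(1) by (simp add: chi4_def)
    show "?T (4 * j + 2) = ?T (4 * j + 1)"
      using m(2) by (subst e(2), subst sum.nat_ivl_Suc') (simp_all add: chi4_def)
    show "?T (4 * j + 3) = ?T (4 * j + 2) - 1 / real (4 * j + 3)"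
      using m(3) by (subst e(3), subst sum.nat_ivl_Suc') (simp_all add: chi4_def)
    show "?T (4 * j + 4) = ?T (4 * j + 3)"
      using m(4) by (subst e(4), subst sum.nat_ivl_Suc') (simp_all add: chi4_def)
  qed
  have dec: "1 / real (4 * j + 3) \<le> 1 / real (4 * j + 1)" for j
    by (simp add: field_simps)
  have base: "2 / 3 \<le> ?T (4 * j + 4)" for j
  proof (induction j)
    case 0
    show ?case using step[of 0] by simp
  next
    case (Suc j)
    show ?case using step[of "Suc j"] Suc dec[of "Suc j"] by (simp add: add.commute)
  qed
  define j where "j = y div 4"
  have T4: "2 / 3 \<le> ?T (4 * j)" if "0 < j"
    using base[of "j - 1"] that by (cases j) (simp_all add: add.commute)
  have T1: "2 / 3 \<le> ?T (4 * j + 1)"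
    using T4 step(1)[of j] by (cases "j = 0") (auto intro: add_increasing2)
  have T3: "2 / 3 \<le> ?T (4 * j + 3)"
    using base[of j] step(4)[of j] by simp
  have "y = 4 * j \<and> 0 < j \<or> y = 4 * j + 1 \<or> y = 4 * j + 2 \<or> y = 4 * j + 3"
    unfolding j_def using assms by linarith
  then show ?thesis
    using T1 T3 T4 step(2)[of j] by metis
qed

definition recip_sum1mod4 :: "nat \<Rightarrow> real" where
  "recip_sum1mod4 x = (\<Sum>s\<in>smooth1mod4 \<inter> {1..x}. 1 / s)"

text \<open>For such \<open>s\<close> the value \<open>sum_chi4 s\<close> is the number of divisors,
  and the map from \<open>(s, d)\<close> to \<open>(d, s div d)\<close> embeds the pairs into the
  square of the index set while turning \<open>1 / s\<close> into a product of two
  reciprocals.\<close>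

lemma sum_chi4_over_smooth_le:
  "(\<Sum>s\<in>smooth1mod4 \<inter> {1..x}. sum_chi4 s / s) \<le> (recip_sum1mod4 x)\<^sup>2"
proof -
  let ?S = "smooth1mod4 \<inter> {1..x}"
  let ?D = "Sigma ?S (\<lambda>s. {d. d dvd s})"
  let ?g = "\<lambda>(s, d). (d, s div d)"
  have fin: "finite ?S" by simp
  have "(\<Sum>s\<in>?S. sum_chi4 s / s) = (\<Sum>s\<in>?S. \<Sum>d | d dvd s. 1 / real s)"
    by (intro sum.cong) (auto simp: sum_chi4_smooth1mod4)
  also have "\<dots> = (\<Sum>(s, d)\<in>?D. 1 / real s)"
    using fin by (subst sum.Sigma) auto
  also have "\<dots> = (\<Sum>z\<in>?D. (\<lambda>(a, b). 1 / real a * (1 / real b)) (?g z))"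
  proof (rule sum.cong[OF refl])
    fix z assume "z \<in> ?D"
    then obtain s d where z: "z = (s, d)" "d dvd s" by auto
    then have "real s = real d * real (s div d)" by (metis dvd_mult_div_cancel of_nat_mult)
    then show "(\<lambda>(s, d). 1 / real s) z = (\<lambda>(a, b). 1 / real a * (1 / real b)) (?g z)" using z by simp
  qed
  also have "\<dots> = (\<Sum>(a, b)\<in>?g ` ?D. 1 / real a * (1 / real b))"
  proof (rule sum.reindex[symmetric, unfolded comp_def])
    show "inj_on ?g ?D"
      by (rule inj_onI) auto
  qed
  also have "\<dots> \<le> (\<Sum>(a, b)\<in>?S \<times> ?S. 1 / real a * (1 / real b))"
  proof (rule sum_mono2)
    show "?g ` ?D \<subseteq> ?S \<times> ?S"
    proof
      fix z assume "z \<in> ?g ` ?D"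
      then obtain s d where sd: "s \<in> ?S" "d dvd s" "z = (d, s div d)" by auto
      then have "d \<in> smooth1mod4" "s div d \<in> smooth1mod4" "d \<le> s" "s div d \<le> s"
        using dvd_in_smooth1mod4 by (auto intro!: dvd_imp_le simp: dvd_div_iff_mult dest: dvd_in_smooth1mod4)
      moreover from this have "0 < d" "0 < s div d" by (auto simp: smooth1mod4_def)
      ultimately show "z \<in> ?S \<times> ?S" using sd by (auto intro: order_trans[OF div_le_dividend])
    qed
  qed auto
  also have "\<dots> = (recip_sum1mod4 x)\<^sup>2"
    by (simp add: recip_sum1mod4_def power2_eq_square sum_product sum.cartesian_product)
  finally show ?thesis .
qed

text \<open>Comparison with a telescoping sum; the sharper bound \<open>2 - 1 / Suc x\<close>
  carries the induction.\<close>

lemma sum_inverse_squares_le: "(\<Sum>t=1..x. 1 / (real t)\<^sup>2) \<le> 2"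
proof -
  have "(\<Sum>t=1..Suc x. 1 / (real t)\<^sup>2) \<le> 2 - 1 / Suc x" for x
  proof (induction x)
    case (Suc x)
    have "1 / (real (Suc (Suc x)))\<^sup>2 \<le> 1 / (real (Suc x) * real (Suc (Suc x)))"
      by (intro divide_left_mono) (auto simp: power2_eq_square)
    also have "\<dots> = 1 / Suc x - 1 / Suc (Suc x)"
      by (simp add: field_simps)
    finally show ?case using Suc by simp
  qed simp
  from this[of "x - 1"] show ?thesis
    by (cases x) (auto intro: order_trans)
qed

text \<open>Only \<open>n = s * t ^ 2\<close> with \<open>s\<close> in \<open>smooth1mod4\<close>
  contribute, each with \<open>sum_chi4 s / (s * t ^ 2)\<close>. Enlarging the range to all pairs
  \<open>(s, t)\<close> gives a product, whose factor over \<open>t\<close> is at most 2.\<close>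

lemma sum_chi4_over_upper:
  "(\<Sum>n | n \<in> {1..x} \<and> odd n. sum_chi4 n / n) \<le> 2 * (recip_sum1mod4 x)\<^sup>2"
proof -
  define N where "N = {n \<in> {1..x}. odd n \<and> sum_chi4 n \<noteq> 0}"
  let ?S = "smooth1mod4 \<inter> {1..x}"
  let ?f = "\<lambda>(s, t). sum_chi4 s / real s * (1 / (real t)\<^sup>2)"
  have "\<forall>n\<in>N. \<exists>z. fst z \<in> smooth1mod4 \<and> n = fst z * snd z ^ 2 \<and> sum_chi4 n = sum_chi4 (fst z)"
    using sum_chi4_cases unfolding N_def by fastforce
  then obtain g where g: "\<And>n. n \<in> N \<Longrightarrow> fst (g n) \<in> smooth1mod4"
      "\<And>n. n \<in> N \<Longrightarrow> n = fst (g n) * snd (g n) ^ 2"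
      "\<And>n. n \<in> N \<Longrightarrow> sum_chi4 n = sum_chi4 (fst (g n))"
    by metis
  have "(\<Sum>n | n \<in> {1..x} \<and> odd n. sum_chi4 n / n) = (\<Sum>n\<in>N. sum_chi4 n / n)"
    unfolding N_def by (rule sum.mono_neutral_right) auto
  also have "\<dots> = (\<Sum>n\<in>N. ?f (g n))"
  proof (rule sum.cong[OF refl])
    fix n assume n: "n \<in> N"
    show "sum_chi4 n / n = ?f (g n)"
      using g(2,3)[OF n] by (simp add: case_prod_beta) (metis of_nat_mult of_nat_power)
  qed
  \<comment> \<open>Whichever decomposition \<open>g\<close> picks, \<open>n\<close> is recovered
    from \<open>g n\<close>, so \<open>g\<close> is injective.\<close>
  also have "\<dots> = (\<Sum>z\<in>g ` N. ?f z)"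
    by (rule sum.reindex[symmetric, unfolded comp_def]) (metis g(2) inj_onI)
  also have "\<dots> \<le> (\<Sum>z\<in>?S \<times> {1..x}. ?f z)"
  proof (rule sum_mono2)
    show "g ` N \<subseteq> ?S \<times> {1..x}"
    proof
      fix z assume "z \<in> g ` N"
      then obtain n where n: "n \<in> N" "z = g n" by auto
      obtain s t where st: "g n = (s, t)" by force
      have *: "n = s * t ^ 2" "1 \<le> n" "n \<le> x" "s \<in> smooth1mod4" using g[OF n(1)] n(1) st by (auto simp: N_def)
      then have "0 < s" "0 < t" by (auto simp: smooth1mod4_def intro: gr0I)
      then have "s * 1 \<le> s * t ^ 2" "t * 1 \<le> t * (s * t)"
        by (intro mult_le_mono; simp)+
      then have "s \<le> n" "t \<le> n" using *(1) by (simp_all add: power2_eq_square mult_ac)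
      then have "s \<le> x" "t \<le> x" using *(3) by simp_all
      then show "z \<in> ?S \<times> {1..x}" using *(4) n(2) st \<open>0 < s\<close> \<open>0 < t\<close> by auto
    qed
    show "0 \<le> ?f z" if "z \<in> ?S \<times> {1..x} - g ` N" for z
      using that by (auto simp: sum_chi4_smooth1mod4)
  qed simp
  also have "\<dots> = (\<Sum>s\<in>?S. sum_chi4 s / s) * (\<Sum>t=1..x. 1 / (real t)\<^sup>2)"
    by (simp only: sum_product sum.cartesian_product)
  also have "\<dots> \<le> (recip_sum1mod4 x)\<^sup>2 * 2"
    by (intro mult_mono sum_chi4_over_smooth_le sum_inverse_squares_le sum_nonneg) auto
  finally show ?thesis by simp
qed

text \<open>Writing \<open>n = m * d\<close> and summing over \<open>d\<close> first, each odd
  \<open>m\<close> contributes \<open>1 / m\<close> times a partial sum of the alternating series,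
  hence at least \<open>(2 / 3) / m\<close>.\<close>

lemma sum_chi4_over_lower:
  "(2 / 3) * (\<Sum>m | m \<in> {1..x} \<and> odd m. 1 / real m) \<le> (\<Sum>n | n \<in> {1..x} \<and> odd n. sum_chi4 n / n)"
proof -
  let ?O = "{m. m \<in> {1..x} \<and> odd m}"
  have "(2 / 3) * (\<Sum>m\<in>?O. 1 / real m) \<le> (\<Sum>m\<in>?O. 1 / real m * (\<Sum>d=1..x div m. chi4 d / d))"
  proof (subst sum_distrib_left, rule sum_mono)
    fix m assume "m \<in> ?O"
    then have "1 \<le> x div m" using div_le_mono[of m x m] by auto
    then show "2 / 3 * (1 / real m) \<le> 1 / real m * (\<Sum>d=1..x div m. chi4 d / d)"
      using mult_left_mono[OF sum_chi4_over_ge, of "x div m" "1 / real m"] by simp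
  qed
  \<comment> \<open>Even \<open>d\<close> may be dropped because \<open>chi4\<close> vanishes there;
    this makes \<open>m * d\<close> range over the odd numbers.\<close>
  also have "\<dots> = (\<Sum>m\<in>?O. \<Sum>d | d \<in> {1..x div m} \<and> odd d. chi4 d / (m * d))"
    unfolding sum_distrib_left
    by (intro sum.cong refl sum.mono_neutral_cong_right) (auto simp: chi4_even)
  also have "\<dots> = (\<Sum>(m, d)\<in>Sigma ?O (\<lambda>m. {d. d \<in> {1..x div m} \<and> odd d}). chi4 d / (m * d))"
    by (subst sum.Sigma) auto
  also have "\<dots> = (\<Sum>(n, d)\<in>Sigma ?O (\<lambda>n. {d. d dvd n}). chi4 d / n)"
  proof (rule sum.reindex_bij_witness[of _ "\<lambda>(n, d). (n div d, d)" "\<lambda>(m, d). (m * d, d)"], goal_cases)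
    case (1 z) then show ?case by auto
  next
    case (2 z)
    then obtain m d where "z = (m, d)" "0 < m" "0 < d" "odd m" "odd d" "d \<le> x div m" by auto
    then show ?case by (auto simp: less_eq_div_iff_mult_less_eq mult.commute)
  next
    case (3 z)
    then show ?case by auto
  next
    case (4 z)
    then obtain n d where nd: "z = (n, d)" "0 < n" "n \<le> x" "odd n" "d dvd n" by auto
    then obtain m where m: "n = d * m" by auto
    then have "0 < m" "0 < d" using nd by auto
    moreover have "m \<le> x" using m nd(3) \<open>0 < d\<close> by (metis le_trans mult_le_mono1 mult_1 One_nat_def Suc_leI)
    ultimately show ?case using nd m by (auto simp: less_eq_div_iff_mult_less_eq mult.commute)
  next
    case (5 z) then show ?case by auto
  qed
  also have "\<dots> = (\<Sum>n\<in>?O. \<Sum>d | d dvd n. chi4 d / n)"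
    by (subst sum.Sigma) auto
  also have "\<dots> = (\<Sum>n\<in>?O. sum_chi4 n / n)"
    by (simp add: sum_chi4_def sum_divide_distrib)
  finally show ?thesis .
qed

lemma harm_le_sum_odd: "harm j \<le> 2 * (\<Sum>m | m \<in> {1..2 * j} \<and> odd m. 1 / real m)"
proof (induction j)
  case (Suc j)
  have "{m. m \<in> {1..2 * Suc j} \<and> odd m} = insert (2 * j + 1) {m. m \<in> {1..2 * j} \<and> odd m}"
    by (auto; presburger)
  then have "(\<Sum>m | m \<in> {1..2 * Suc j} \<and> odd m. 1 / real m) =
      1 / real (2 * j + 1) + (\<Sum>m | m \<in> {1..2 * j} \<and> odd m. 1 / real m)"
    by simp
  moreover have "inverse (real (Suc j)) \<le> 2 * (1 / real (2 * j + 1))"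
    by (simp add: field_simps)
  ultimately show ?case using Suc by (simp add: harm_Suc)
qed (simp add: harm_expand)

text \<open>With \<open>R\<close> the reciprocal sum up to \<open>2 * j\<close>, the lower and upper
  estimates give \<open>harm j / 3 \<le> 2 * R ^ 2\<close>, whence the factor 6; the harmonic
  numbers diverge.\<close>

lemma recip_sum1mod4_unbounded: "\<exists>x. B \<le> recip_sum1mod4 x"
proof -
  have "\<forall>\<^sub>F j in sequentially. 6 * B\<^sup>2 \<le> (harm j :: real)"
    using harm_at_top by (auto simp: filterlim_at_top)
  then obtain j where j: "6 * B\<^sup>2 \<le> (harm j :: real)"
    by (auto simp: eventually_sequentially)
  have "B\<^sup>2 \<le> (recip_sum1mod4 (2 * j))\<^sup>2"
    using j harm_le_sum_odd[of j] sum_chi4_over_lower[of "2 * j"] sum_chi4_over_upper[of "2 * j"]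
    by linarith
  then have "B \<le> recip_sum1mod4 (2 * j)"
    by (rule power2_le_imp_le) (auto simp: recip_sum1mod4_def intro: sum_nonneg)
  then show ?thesis ..
qed

section \<open>The Hardy--Littlewood function\<close>

definition hardy_littlewood :: "real \<Rightarrow> real" where
  "hardy_littlewood u = (\<Sum>n. sin (u / Suc n) / Suc n)"

lemma abs_sin_over_le: "0 < n \<Longrightarrow> \<bar>sin (u / real n) / real n\<bar> \<le> \<bar>u\<bar> * (1 / (real n)\<^sup>2)"
  using abs_sin_x_le_abs_x[of "u / n"] by (simp add: field_simps power2_eq_square)

lemma summable_hardy_littlewood: "summable (\<lambda>n. sin (u / Suc n) / Suc n)"
proof (rule summable_comparison_test')
  show "summable (\<lambda>n. \<bar>u\<bar> * (1 / (real n + 1)\<^sup>2))"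
    using sums_summable[OF inverse_squares_sums] by (intro summable_mult) (simp add: add.commute)
  show "norm (sin (u / Suc n) / Suc n) \<le> \<bar>u\<bar> * (1 / (real n + 1)\<^sup>2)" if "0 \<le> n" for n
    using abs_sin_over_le[of "Suc n" u] by (simp add: add.commute)
qed

text \<open>The terms of index \<open>n > M\<close> are at most \<open>u / n ^ 2\<close>, which is
  below the telescoping difference \<open>u / (n - 1) - u / n\<close>.\<close>

lemma hardy_littlewood_le_partial_sum:
  fixes M :: nat
  assumes "0 \<le> u" "0 < M"
  shows "hardy_littlewood u \<le> (\<Sum>n=1..M. sin (u / n) / n) + u / M"
proof -
  let ?t = "\<lambda>n. sin (u / Suc n) / Suc n"
  let ?g = "\<lambda>n::nat. u * (1 / real (n + M))"
  have "(\<lambda>n. 1 / real (n + M)) \<longlonglongrightarrow> 0"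
    by (rule LIMSEQ_ignore_initial_segment[OF lim_1_over_n])
  then have "?g \<longlonglongrightarrow> u * 0"
    by (intro tendsto_mult tendsto_const)
  then have tel: "(\<lambda>n. ?g n - ?g (Suc n)) sums (?g 0 - u * 0)"
    by (rule telescope_sums')
  have le: "?t (n + M) \<le> ?g n - ?g (Suc n)" for n
  proof -
    have "?t (n + M) \<le> u * (1 / (real (Suc (n + M)))\<^sup>2)"
      using abs_sin_over_le[of "Suc (n + M)" u] assms(1) by (simp only: abs_of_nonneg abs_le_iff zero_less_Suc)
    also have "\<dots> \<le> u * (1 / (real (n + M) * real (Suc (n + M))))"
      using assms by (intro mult_left_mono divide_left_mono) (auto simp: power2_eq_square)
    also have "\<dots> = ?g n - ?g (Suc n)"
      using assms by (simp add: field_simps)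
    finally show ?thesis .
  qed
  have "hardy_littlewood u = (\<Sum>n. ?t (n + M)) + (\<Sum>n<M. ?t n)"
    unfolding hardy_littlewood_def by (rule suminf_split_initial_segment[OF summable_hardy_littlewood])
  also have "(\<Sum>n. ?t (n + M)) \<le> (\<Sum>n. ?g n - ?g (Suc n))"
    using summable_ignore_initial_segment[OF summable_hardy_littlewood[of u], of M] tel
    by (intro suminf_le le) (auto simp: sums_iff)
  also have "\<dots> = u / M"
    using tel by (simp add: sums_iff)
  also have "(\<Sum>n<M. ?t n) = (\<Sum>n=1..M. sin (u / n) / n)"
    by (rule sum.reindex_bij_witness[of _ "\<lambda>n. n - 1" Suc]) auto
  finally show ?thesis by simp
qed

section \<open>Averaging the sine series along an arithmetic progression\<close>

text \<open>Multiplication by \<open>2 * sin (b / 2)\<close> makes the sum telescope to a difference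
  of two cosines. The product form also covers \<open>sin (b / 2) = 0\<close>.\<close>

lemma abs_sum_sin_arith_progression:
  "\<bar>\<Sum>k<K. sin (a + real k * b)\<bar> * \<bar>sin (b / 2)\<bar> \<le> 1"
proof -
  have "(\<Sum>k<K. sin (a + real k * b)) * sin (b / 2) * 2 = cos (a - b / 2) - cos (a + real K * b - b / 2)"
  proof (induction K)
    case (Suc K)
    have "2 * (sin (a + K * b) * sin (b / 2)) = cos (a + K * b - b / 2) - cos (a + K * b + b / 2)"
      by (simp add: cos_diff cos_add)
    moreover have "a + real (Suc K) * b - b / 2 = a + K * b + b / 2"
      by (simp add: algebra_simps)
    ultimately show ?case using Suc by (simp add: algebra_simps)
  qed simp
  moreover have "\<bar>cos (a - b / 2) - cos (a + real K * b - b / 2)\<bar> \<le> 2"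
    using abs_cos_le_one[of "a - b / 2"] abs_cos_le_one[of "a + real K * b - b / 2"] by linarith
  ultimately show ?thesis by (simp flip: abs_mult)
qed

text \<open>A crude linear bound suffices: with \<open>x = pi * y \<le> 2\<close> the cubic Taylor
  estimate gives \<open>sin x \<ge> x - x ^ 3 / 6 \<ge> x / 3\<close>, and
  \<open>x \<ge> 2 * y\<close>.\<close>

lemma sin_pi_times_ge:
  assumes "0 \<le> y" "y \<le> 1 / 2"
  shows "y / 2 \<le> sin (pi * y)"
proof -
  define x where "x = pi * y"
  have x: "0 \<le> x" "x \<le> 2"
    using assms pi_less_4 mult_mono[of pi 4 y "1/2"] by (auto simp: x_def)
  have "\<bar>sin x - (\<Sum>m<3. sin_coeff m * x ^ m)\<bar> \<le> inverse (fact 3) * \<bar>x\<bar> ^ 3"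
    by (rule Maclaurin_sin_bound)
  then have "\<bar>sin x - x\<bar> \<le> x ^ 3 / 6"
    using x by (simp add: sin_coeff_def eval_nat_numeral field_simps)
  then have "x - x ^ 3 / 6 \<le> sin x" by linarith
  moreover have "x ^ 3 \<le> 4 * x"
    using x mult_mono[of x 2 x 2] mult_right_mono[of "x * x" 4 x] by (simp add: power3_eq_cube)
  ultimately have "x / 3 \<le> sin x" by simp
  moreover have "2 * y \<le> x" unfolding x_def using assms pi_ge_two by (intro mult_right_mono)
  ultimately show ?thesis using assms by (simp add: x_def)
qed

text \<open>A non-integral fraction \<open>N / n\<close> has distance at least \<open>1 / n\<close>
  from every integer. Reduction modulo \<open>n\<close> and the reflection of \<open>r\<close> to
  \<open>n - r\<close> bring the argument into the range of the linear bound.\<close>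

lemma abs_sin_pi_times_ratio_ge:
  fixes N n :: nat
  assumes "0 < n" "\<not> n dvd N"
  shows "1 / (2 * n) \<le> \<bar>sin (pi * (N / n))\<bar>"
proof -
  define r where "r = N mod n"
  define q where "q = N div n"
  have r: "0 < r" "r < n" using assms by (auto simp: r_def dvd_eq_mod_eq_0)
  have "real N = real q * n + r"
    unfolding q_def r_def by (metis div_mult_mod_eq of_nat_add of_nat_mult)
  then have "pi * (N / n) = pi * (r / n) + q * pi"
    using assms by (simp add: field_simps)
  then have *: "\<bar>sin (pi * (N / n))\<bar> = \<bar>sin (pi * (r / n))\<bar>"
    by (simp add: sin_add abs_mult sin_npi cos_npi)
  show ?thesis
  proof (cases "2 * r \<le> n")
    case True
    have "1 / (2 * n) \<le> (r / n) / 2" using r by (simp add: field_simps)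
    also have "\<dots> \<le> sin (pi * (r / n))"
      using True r by (intro sin_pi_times_ge) (auto simp: field_simps)
    finally show ?thesis using * by simp
  next
    case False
    have "1 / (2 * n) \<le> ((n - r) / n) / 2" using r by (simp add: field_simps)
    also have "\<dots> \<le> sin (pi * ((n - r) / n))"
      using False r by (intro sin_pi_times_ge) (auto simp: field_simps)
    also have "pi * ((n - r) / n) = pi - pi * (r / n)"
      using r by (simp add: field_simps of_nat_diff)
    finally show ?thesis using * by simp
  qed
qed

text \<open>Otherwise the average over the points \<open>u k\<close> is at least \<open>-2\<close>.
  The terms with \<open>n dvd N\<close> all push it down, by an amount governed by the divisor sum
  of \<open>1 / n\<close>, while the sums over \<open>k\<close> for the other \<open>n\<close>
  cancel up to a bounded average.\<close>

lemma ex_hardy_littlewood_less: "\<exists>u>0. hardy_littlewood u < - (pi / 2)"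
proof (rule ccontr)
  assume neg: "\<not> ?thesis"
  \<comment> \<open>Any bound above 33 would do: the final comparison, divided by \<open>N\<close>,
    would require \<open>-2 \<le> 1 / 2 - 34 / 2 + 14\<close>.\<close>
  obtain x where x: "34 \<le> recip_sum1mod4 x"
    using recip_sum1mod4_unbounded by blast
  \<comment> \<open>A product over the whole set is divisible by each of its members, so the
    divisors of \<open>N\<close> include every summation index of
    \<open>recip_sum1mod4 x\<close>.\<close>
  define N where "N = \<Prod>(smooth1mod4 \<inter> {1..x})"
  have N: "N \<in> smooth1mod4" unfolding N_def by (rule prod_in_smooth1mod4) auto
  then have N0: "0 < N" by (simp add: smooth1mod4_def)
  define u where "u k = pi / 2 * (3 * N + 1) + real k * (2 * pi * N)" for k :: nat
  have u0: "0 < u k" for k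
    unfolding u_def by (intro add_pos_nonneg) auto
  have u_le: "u k \<le> 8 * (real N)\<^sup>2" if "k < N" for k
  proof -
    have "pi / 2 * (3 * N + 1) \<le> 2 * pi * N" using N0 by (simp add: field_simps)
    then have "u k \<le> 2 * pi * N * real (k + 1)" by (simp add: u_def algebra_simps)
    also have "\<dots> \<le> 8 * real N * real N" using that pi_less_4 by (intro mult_mono) auto
    finally show ?thesis by (simp add: power2_eq_square)
  qed
  \<comment> \<open>The cutoff balances two errors: the tail \<open>u k / ?M\<close> stays below 8,
    and \<open>?M\<close> terms of size \<open>2 / N\<close> add up to only
    \<open>2 * N\<close>.\<close>
  let ?M = "N\<^sup>2"
  let ?c = "\<lambda>n. (\<Sum>k<N. sin (u k / n) / n)"
  have arg: "u k / real n = pi / 2 * ((3 * N + 1) / n) + real k * (2 * (pi * (N / n)))" if "0 < n" for k n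
    using that by (simp add: u_def field_simps)
  have dvd: "?c n \<le> N * (of_bool (n = 1) / 2 - 1 / (2 * real n))" if n: "n dvd N" for n
  proof -
    have n0: "0 < n" using n N0 by (rule dvd_pos_nat[rotated])
    obtain q where q: "N = n * q" using n by blast
    \<comment> \<open>The cofactor \<open>q\<close> lies in \<open>smooth1mod4\<close> too. Being 1
      mod 4, it puts \<open>u k / n\<close> at \<open>pi / (2 * n) + 3 / 2 * pi\<close> modulo
      \<open>2 * pi\<close>, independently of \<open>k\<close>.\<close>
    have "q mod 4 = 1" using N q dvd_in_smooth1mod4 smooth1mod4_mod4 by simp
    then obtain i where i: "q = 4 * i + 1" by (metis mult_div_mod_eq)
    have "sin (u k / n) = - cos (pi / (2 * n))" for k
    proof -
      have "u k / n = (pi / (2 * n) + 3 / 2 * pi) + 2 * real (3 * i + k * q) * pi"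
        using n0 unfolding u_def q i by (simp add: field_simps)
      then have "sin (u k / n) = sin (pi / (2 * n) + 3 / 2 * pi)"
        by (simp only: sin_add[of _ "2 * real _ * pi"] sin_2npi cos_2npi mult_1_right mult_zero_right add_0_right)
      also have "\<dots> = - cos (pi / (2 * n))"
        by (simp only: sin_add sin_3over2_pi cos_3over2_pi mult_zero_right mult_minus_right mult_1_right add_0_left)
      finally show ?thesis .
    qed
    then have c: "?c n = - (N * (cos (pi / (2 * n)) / n))" by simp
    show ?thesis
    \<comment> \<open>At \<open>n = 1\<close> the cosine is 0, which the \<open>of_bool\<close> term
      compensates; for larger \<open>n\<close> the cosine is at least 1/2.\<close>
    proof (cases "n = 1")
      case False
      then have "pi / (2 * n) \<le> pi / 3" using n0 by (intro divide_left_mono) auto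
      then have "1 / 2 \<le> cos (pi / (2 * n))"
        using n0 cos_monotone_0_pi_le[of "pi / (2 * n)" "pi / 3"] by (simp add: cos_60)
      then have "1 / (2 * n) \<le> cos (pi / (2 * n)) / n"
        using n0 by (simp add: field_simps)
      then have "real N * (1 / (2 * n)) \<le> real N * (cos (pi / (2 * n)) / n)"
        by (intro mult_left_mono) auto
      then show ?thesis unfolding c using False by simp
    next
      case True
      then show ?thesis unfolding c by simp
    qed
  qed
  \<comment> \<open>The progression has step \<open>2 * pi * N / n\<close>, so its sum is at most
    the reciprocal of \<open>?s\<close>. The bound \<open>1 / (2 * n)\<close> for \<open>?s\<close>
    serves small \<open>n\<close>; beyond \<open>2 * N\<close> the argument is below
    \<open>pi / 2\<close> and the stronger bound \<open>N / (2 * n)\<close> holds.\<close>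
  have ndvd: "?c n \<le> of_bool (n \<le> 2 * N) * 2 + 2 / N" if n: "\<not> n dvd N" "0 < n" for n
  proof -
    let ?s = "\<bar>sin (pi * (N / n))\<bar>"
    have s0: "1 / (2 * n) \<le> ?s" using n by (intro abs_sin_pi_times_ratio_ge)
    have spos: "0 < ?s" by (rule less_le_trans[OF _ s0]) (use n in simp)
    have "\<bar>\<Sum>k<N. sin (u k / n)\<bar> * ?s \<le> 1"
      using abs_sum_sin_arith_progression[of "pi / 2 * ((3 * N + 1) / n)" "2 * (pi * (N / n))" N]
      unfolding arg[OF n(2)] by simp
    then have "\<bar>\<Sum>k<N. sin (u k / n)\<bar> \<le> 1 / ?s"
      using spos by (simp only: pos_le_divide_eq)
    then have "(\<Sum>k<N. sin (u k / n)) / n \<le> (1 / ?s) / n"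
      by (intro divide_right_mono) auto
    then have c: "?c n \<le> 1 / (?s * n)"
      by (simp only: sum_divide_distrib divide_divide_eq_left)
    show ?thesis
    proof (cases "n \<le> 2 * N")
      case True
      have "1 / (?s * n) \<le> 1 / (1 / (2 * n) * n)"
        using s0 spos n by (intro divide_left_mono mult_right_mono mult_pos_pos) auto
      also have "\<dots> = 2" using n by simp
      finally have "?c n \<le> 2 + 2 / N" using c by (intro add_increasing2) auto
      then show ?thesis using True by simp
    next
      case False
      have "(N / n) / 2 \<le> sin (pi * (N / n))"
        using False n by (intro sin_pi_times_ge) (auto simp: field_simps)
      then have "(N / n) / 2 \<le> ?s" by linarith
      then have "1 / (?s * n) \<le> 1 / ((N / n) / 2 * n)"
        using spos n N0 by (intro divide_left_mono mult_right_mono mult_pos_pos) auto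
      then show ?thesis using c n False by simp
    qed
  qed
  have sigma: "34 \<le> (\<Sum>n | n dvd N. 1 / real n)"
  proof -
    have "s dvd N" if "s \<in> smooth1mod4 \<inter> {1..x}" for s
      unfolding N_def using that by (intro dvd_prodI) auto
    then have "recip_sum1mod4 x \<le> (\<Sum>n | n dvd N. 1 / real n)"
      unfolding recip_sum1mod4_def using N0 by (intro sum_mono2) (auto intro: finite_divisors_nat)
    with x show ?thesis by simp
  qed
  have D: "{n \<in> {1..?M}. n dvd N} = {n. n dvd N}"
  proof -
    have "n \<le> N\<^sup>2" if "n dvd N" for n
    proof -
      have "n \<le> N" using that N0 by (rule dvd_imp_le)
      also have "N \<le> N\<^sup>2" using N0 by (simp add: power2_eq_square)
      finally show ?thesis .
    qed
    then show ?thesis using N0 by (auto intro: Suc_leI dvd_pos_nat)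
  qed
  have "(\<Sum>n=1..?M. ?c n) = (\<Sum>n | n \<in> {1..?M} \<and> n dvd N. ?c n) + (\<Sum>n | n \<in> {1..?M} \<and> \<not> n dvd N. ?c n)"
    by (subst sum.union_disjoint[symmetric]) (auto intro: sum.cong)
  also have "(\<Sum>n | n \<in> {1..?M} \<and> n dvd N. ?c n) \<le> (\<Sum>n | n dvd N. N * (of_bool (n = 1) / 2 - 1 / (2 * real n)))"
    unfolding D
  proof (rule sum_mono)
    fix n assume "n \<in> {n. n dvd N}"
    then show "?c n \<le> N * (of_bool (n = 1) / 2 - 1 / (2 * real n))" using dvd[of n] by simp
  qed
  also have "\<dots> = N / 2 - N / 2 * (\<Sum>n | n dvd N. 1 / real n)"
  proof -
    have "(\<Sum>n | n dvd N. N * (of_bool (n = 1) / 2 - 1 / (2 * real n))) =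
        (\<Sum>n | n dvd N. of_bool (n = 1) * (N / 2)) - (\<Sum>n | n dvd N. N / 2 * (1 / real n))"
      unfolding sum_subtractf[symmetric] by (intro sum.cong) (auto simp: field_simps)
    also have "(\<Sum>n | n dvd N. of_bool (n = 1) * (real N / 2)) = (\<Sum>n | n dvd N. if n = 1 then N / 2 else 0)"
      by (intro sum.cong) auto
    also have "\<dots> = N / 2"
      using N0 by (simp add: finite_divisors_nat)
    finally show ?thesis by (simp add: sum_distrib_left)
  qed
  also have "(\<Sum>n | n \<in> {1..?M} \<and> \<not> n dvd N. ?c n) \<le>
      (\<Sum>n | n \<in> {1..?M} \<and> \<not> n dvd N. of_bool (n \<le> 2 * N) * 2 + 2 / real N)"
    by (intro sum_mono ndvd) auto
  also have "\<dots> \<le> (\<Sum>n=1..?M. of_bool (n \<le> 2 * N) * 2 + 2 / real N)"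
    by (intro sum_mono2) auto
  also have "\<dots> = (\<Sum>n=1..?M. of_bool (n \<le> 2 * N) * (2::real)) + 2 * real N"
    using N0 by (simp add: sum.distrib power2_eq_square)
  also have "(\<Sum>n=1..?M. of_bool (n \<le> 2 * N) * (2::real)) \<le> (\<Sum>n=1..2 * N. (2::real))"
  proof -
    have "(\<Sum>n=1..?M. of_bool (n \<le> 2 * N) * (2::real)) = (\<Sum>n\<in>{1..?M} \<inter> {1..2 * N}. 2)"
      by (intro sum.mono_neutral_cong_right) auto
    also have "\<dots> \<le> (\<Sum>n=1..2 * N. (2::real))"
      by (intro sum_mono2) auto
    finally show ?thesis .
  qed
  \<comment> \<open>The \<open>6 * N\<close> collects \<open>2 * (2 * N)\<close> from
    \<open>n \<le> 2 * N\<close> and \<open>2 * N\<close> from the terms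
    \<open>2 / N\<close>.\<close>
  finally have main: "(\<Sum>n=1..?M. ?c n) \<le> N / 2 - N / 2 * (\<Sum>n | n dvd N. 1 / real n) + 6 * N"
    by simp
  have "- (N * 2) \<le> N * - (pi / 2)" using pi_less_4 N0 by simp
  also have "\<dots> = (\<Sum>k<N. - (pi / 2))" by simp
  also have "\<dots> \<le> (\<Sum>k<N. hardy_littlewood (u k))"
    using neg u0 by (intro sum_mono) (meson not_less)
  also have "\<dots> \<le> (\<Sum>k<N. (\<Sum>n=1..?M. sin (u k / n) / n) + 8)"
  proof (rule sum_mono)
    fix k assume "k \<in> {..<N}"
    then have "u k / ?M \<le> 8" using u_le[of k] N0 by (simp add: field_simps)
    then show "hardy_littlewood (u k) \<le> (\<Sum>n=1..?M. sin (u k / n) / n) + 8"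
      using hardy_littlewood_le_partial_sum[of "u k" ?M] u0[of k] N0 by force
  qed
  also have "\<dots> = (\<Sum>n=1..?M. ?c n) + 8 * N"
    by (simp add: sum.distrib) (rule sum.swap)
  also have "\<dots> \<le> N / 2 - N / 2 * 34 + 14 * N"
    using main mult_left_mono[OF sigma, of "N / 2"] by simp
  finally show False using N0 by simp
qed

section \<open>Partial fractions and the Borel transform\<close>

text \<open>Derivative of the reflection formula for the entire function \<open>rGamma\<close>,
  divided by the formula itself.\<close>

lemma Digamma_reflection_complex:
  fixes z :: complex
  assumes "z \<notin> \<int>"
  shows "Digamma (1 - z) - Digamma z = of_real pi * cot (of_real pi * z)"
proof -
  have "1 - z \<notin> \<int>"
    using assms Ints_diff[of 1 "1 - z"] by auto
  then have nz: "z \<notin> \<int>\<^sub>\<le>\<^sub>0" "1 - z \<notin> \<int>\<^sub>\<le>\<^sub>0"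
    using assms by (auto dest: nonpos_Ints_Int)
  have eq: "(\<lambda>z. rGamma z * rGamma (1 - z)) = (\<lambda>z::complex. sin (of_real pi * z) / of_real pi)"
    by (rule ext) (rule rGamma_reflection_complex)
  have "((\<lambda>z. rGamma z * rGamma (1 - z)) has_field_derivative
      rGamma z * rGamma (1 - z) * (Digamma (1 - z) - Digamma z)) (at z)"
    using nz by (auto intro!: derivative_eq_intros simp: algebra_simps)
  moreover have "((\<lambda>z. sin (of_real pi * z) / of_real pi) has_field_derivative cos (of_real pi * z)) (at z)"
    by (auto intro!: derivative_eq_intros)
  ultimately have "rGamma z * rGamma (1 - z) * (Digamma (1 - z) - Digamma z) = cos (of_real pi * z)"
    unfolding eq by (rule DERIV_unique)
  moreover have "sin (of_real pi * z) \<noteq> 0"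
    using nz by (metis rGamma_reflection_complex rGamma_eq_zero_iff divide_eq_0_iff mult_eq_0_iff)
  ultimately show ?thesis
    unfolding rGamma_reflection_complex cot_def by (simp add: field_simps)
qed

text \<open>The left side of \<open>t / (1 - exp (- t)) - t / 2 = (t / 2) * coth (t / 2)\<close> is
  expanded through the cotangent at an imaginary argument: the Digamma series provides the partial
  fractions and the reflection formula the closed form.\<close>

lemma partial_fractions_inverse_one_minus_exp:
  fixes t :: real
  assumes "0 < t"
  shows "(\<lambda>n. 2 * t\<^sup>2 / (t\<^sup>2 + (2 * pi * Suc n)\<^sup>2)) sums (t / (1 - exp (- t)) - 1 - t / 2)"
proof -
  \<comment> \<open>Chosen so that \<open>pi * z = \<i> * t / 2\<close> and
    \<open>z * z = - (t / (2 * pi)) ^ 2\<close>.\<close>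
  define z where "z = \<i> * of_real (t / (2 * pi))"
  have im: "Im z \<noteq> 0" using assms by (simp add: z_def)
  then have zi: "z \<notin> \<int>" and z0: "z \<noteq> 0" "1 + z \<noteq> 0" "1 - z \<noteq> 0"
    by (auto simp: complex_eq_iff elim!: Ints_cases)
  have z2: "z * z = - of_real ((t / (2 * pi))\<^sup>2)"
  proof -
    have "z * z = (\<i> * \<i>) * (of_real (t / (2 * pi)) * of_real (t / (2 * pi)))"
      unfolding z_def by (simp only: mult_ac)
    then show ?thesis by (simp add: power2_eq_square)
  qed
  have D: "(\<lambda>k. inverse (of_nat (Suc k)) - inverse (c + of_nat k)) sums (Digamma c + euler_mascheroni)"
    if "c \<noteq> 0" for c :: complex
    using summable_sums[OF summable_Digamma[OF that]] by (simp add: Digamma_def)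
  have "(\<lambda>k. inverse (1 + z + of_nat k) - inverse (1 - z + of_nat k)) sums (Digamma (1 - z) - Digamma (1 + z))"
    using sums_diff[OF D[OF z0(3)] D[OF z0(2)]] by simp
  then have "(\<lambda>k. z * (inverse (1 + z + of_nat k) - inverse (1 - z + of_nat k))) sums
      (z * (Digamma (1 - z) - Digamma (1 + z)))"
    by (rule sums_mult)
  moreover have "z * (inverse (1 + z + of_nat k) - inverse (1 - z + of_nat k)) =
      of_real (2 * t\<^sup>2 / (t\<^sup>2 + (2 * pi * Suc k)\<^sup>2))" for k
  proof -
    define N :: complex where "N = of_nat (Suc k)"
    have e: "1 + z + of_nat k = N + z" "1 - z + of_nat k = N - z" by (simp_all add: N_def)
    have n0: "N + z \<noteq> 0" "N - z \<noteq> 0" using im by (auto simp: complex_eq_iff N_def)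
    have "z * (inverse (N + z) - inverse (N - z)) = - 2 * (z * z) / ((N + z) * (N - z))"
      using n0 by (simp add: field_simps)
    also have "(N + z) * (N - z) = of_real ((real (Suc k))\<^sup>2 + (t / (2 * pi))\<^sup>2)"
      by (simp add: algebra_simps z2 N_def power2_eq_square)
    also have "- 2 * (z * z) = of_real (2 * (t / (2 * pi))\<^sup>2)"
      by (simp add: z2)
    also have "of_real (2 * (t / (2 * pi))\<^sup>2) / of_real ((real (Suc k))\<^sup>2 + (t / (2 * pi))\<^sup>2) =
        (of_real (2 * t\<^sup>2 / (t\<^sup>2 + (2 * pi * Suc k)\<^sup>2)) :: complex)"
    proof -
      have "2 * (t / (2 * pi))\<^sup>2 / ((real (Suc k))\<^sup>2 + (t / (2 * pi))\<^sup>2) =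
          2 * t\<^sup>2 / (t\<^sup>2 + (2 * pi * Suc k)\<^sup>2)"
        using assms by (simp add: divide_simps power_mult_distrib add_nonneg_eq_0_iff)
      then show ?thesis by (simp only: of_real_divide[symmetric])
    qed
    finally show ?thesis unfolding e .
  qed
  moreover have "z * (Digamma (1 - z) - Digamma (1 + z)) = of_real (t / (1 - exp (- t)) - 1 - t / 2)"
  proof -
    define y where "y = t / 2"
    have y: "0 < y" "t = 2 * y" using assms by (simp_all add: y_def)
    have "of_real pi * z = \<i> * of_real y" by (simp add: z_def y_def)
    have ey: "exp y - exp (- y) \<noteq> 0" using y by simp
    have cot: "\<i> * of_real y * cot (\<i> * of_real y) = of_real (y * ((exp y + exp (- y)) / (exp y - exp (- y))))"
    proof -
      let ?E = "of_real (exp y) :: complex" and ?E' = "of_real (exp (- y)) :: complex"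
      have s: "sin (\<i> * of_real y) = \<i> * ((?E - ?E') / 2)"
        by (simp add: sin_i_times exp_minus flip: exp_of_real)
      have c: "cos (\<i> * of_real y) = (?E + ?E') / 2"
        by (simp add: cos_i_times exp_minus flip: exp_of_real)
      have "?E - ?E' \<noteq> 0" using ey by (metis of_real_diff of_real_eq_0_iff)
      then have "\<i> * of_real y * cot (\<i> * of_real y) = of_real y * ((?E + ?E') / (?E - ?E'))"
        unfolding cot_def s c by (simp add: divide_simps) (simp add: algebra_simps)
      then show ?thesis by simp
    qed
    have "Digamma (1 + z) = Digamma z + 1 / z"
      using Digamma_plus1[OF z0(1)] by (simp add: add.commute)
    then have "z * (Digamma (1 - z) - Digamma (1 + z)) = z * (of_real pi * cot (of_real pi * z)) - 1"
      using Digamma_reflection_complex[OF zi] z0 by (simp add: algebra_simps)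
    also have "\<dots> = \<i> * of_real y * cot (\<i> * of_real y) - 1"
      using \<open>of_real pi * z = \<i> * of_real y\<close> by (metis mult.assoc mult.commute)
    also have "\<dots> = of_real (y * ((exp y + exp (- y)) / (exp y - exp (- y))) - 1)"
      unfolding cot by simp
    also have "y * ((exp y + exp (- y)) / (exp y - exp (- y))) - 1 = t / (1 - exp (- t)) - 1 - t / 2"
    proof -
      have "exp (- t) = exp (- y) / exp y" using y by (simp add: exp_diff[symmetric])
      then have "1 - exp (- t) = (exp y - exp (- y)) / exp y" by (simp add: field_simps)
      then show ?thesis using ey y by (simp add: field_simps)
    qed
    finally show ?thesis .
  qed
  ultimately show ?thesis
    by (simp only: sums_of_real_iff)
qed

section \<open>Lipschitz bounds and growth\<close>

lemma abs_sin_diff_le: "\<bar>sin a - sin b\<bar> \<le> \<bar>a - b\<bar>" for a b :: real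
proof -
  have "\<bar>sin a - sin b\<bar> = 2 * \<bar>sin ((a - b) / 2)\<bar> * \<bar>cos ((a + b) / 2)\<bar>"
    by (simp add: sin_diff_sin abs_mult)
  also have "\<dots> \<le> 2 * \<bar>(a - b) / 2\<bar> * 1"
    by (intro mult_mono abs_sin_x_le_abs_x) auto
  finally show ?thesis by simp
qed

text \<open>Termwise differences are at most \<open>\<bar>u - v\<bar> / n ^ 2\<close>, and
  \<open>pi ^ 2 / 6 \<le> 3\<close> already follows from \<open>pi < 4\<close>.\<close>

lemma hardy_littlewood_lipschitz: "\<bar>hardy_littlewood u - hardy_littlewood v\<bar> \<le> 3 * \<bar>u - v\<bar>"
proof -
  let ?d = "\<lambda>n. sin (u / Suc n) / Suc n - sin (v / Suc n) / Suc n"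
  have sq: "(\<lambda>n. \<bar>u - v\<bar> * (1 / (real (Suc n))\<^sup>2)) sums (\<bar>u - v\<bar> * (pi\<^sup>2 / 6))"
    using inverse_squares_sums by (intro sums_mult) (simp add: add.commute)
  have le: "norm (?d n) \<le> \<bar>u - v\<bar> * (1 / (real (Suc n))\<^sup>2)" for n
  proof -
    have "\<bar>?d n\<bar> = \<bar>sin (u / Suc n) - sin (v / Suc n)\<bar> / Suc n"
      by (simp add: diff_divide_distrib[symmetric] del: of_nat_Suc)
    also have "\<dots> \<le> \<bar>u / Suc n - v / Suc n\<bar> / Suc n"
      by (intro divide_right_mono abs_sin_diff_le) auto
    also have "\<dots> = \<bar>u - v\<bar> * (1 / (real (Suc n))\<^sup>2)"
      by (simp add: diff_divide_distrib[symmetric] power2_eq_square del: of_nat_Suc)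
    finally show ?thesis by simp
  qed
  have "hardy_littlewood u - hardy_littlewood v = (\<Sum>n. ?d n)"
    unfolding hardy_littlewood_def by (intro suminf_diff summable_hardy_littlewood)
  then have "\<bar>hardy_littlewood u - hardy_littlewood v\<bar> \<le> (\<Sum>n. \<bar>u - v\<bar> * (1 / (real (Suc n))\<^sup>2))"
    using norm_suminf_le[OF le] sq by (simp add: sums_iff)
  also have "\<dots> = \<bar>u - v\<bar> * (pi\<^sup>2 / 6)" using sq by (simp add: sums_iff)
  also have "\<dots> \<le> \<bar>u - v\<bar> * 3"
    using power_mono[of pi 4 2] pi_less_4 by (intro mult_left_mono) auto
  finally show ?thesis by (simp add: mult.commute)
qed

definition borel_transform :: "real \<Rightarrow> real" where
  "borel_transform w = 1 / 2 + hardy_littlewood (w / (2 * pi)) / pi"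

text \<open>The rescaling leaves the constant \<open>3 / (2 * pi ^ 2)\<close>, which is below 1.
  This bound yields measurability, linear growth and later the quadratic majorant.\<close>

lemma borel_transform_lipschitz: "\<bar>borel_transform w - borel_transform v\<bar> \<le> \<bar>w - v\<bar>"
proof -
  have "\<bar>borel_transform w - borel_transform v\<bar> =
      \<bar>hardy_littlewood (w / (2 * pi)) - hardy_littlewood (v / (2 * pi))\<bar> / pi"
    by (simp add: borel_transform_def diff_divide_distrib[symmetric])
  also have "\<dots> \<le> 3 * \<bar>w / (2 * pi) - v / (2 * pi)\<bar> / pi"
    by (intro divide_right_mono hardy_littlewood_lipschitz) auto
  also have "\<dots> = (3 / (2 * pi * pi)) * \<bar>w - v\<bar>"
    by (simp add: diff_divide_distrib[symmetric])
  also have "\<dots> \<le> 1 * \<bar>w - v\<bar>"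
    using mult_mono[OF pi_ge_two pi_ge_two] by (intro mult_right_mono) (auto simp: field_simps)
  finally show ?thesis by simp
qed

lemma borel_measurable_borel_transform [measurable]: "borel_transform \<in> borel_measurable borel"
proof (rule borel_measurable_continuous_onI)
  have "1-lipschitz_on UNIV borel_transform"
    by (rule lipschitz_onI) (simp_all add: dist_real_def borel_transform_lipschitz)
  then show "continuous_on UNIV borel_transform" by (rule lipschitz_on_continuous_on)
qed

lemma abs_borel_transform_le: "\<bar>borel_transform w\<bar> \<le> 1 + \<bar>w\<bar>"
proof -
  have "borel_transform 0 = 1 / 2" by (simp add: borel_transform_def hardy_littlewood_def)
  then show ?thesis using borel_transform_lipschitz[of w 0] by linarith
qed

section \<open>Integral representations\<close>

lemma has_bochner_integral_power_exp:
  fixes y :: real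
  assumes "0 < y"
  shows "has_bochner_integral lborel (\<lambda>w. indicator {0<..} w * (w ^ s * exp (- (y * w)))) (fact s / y ^ Suc s)"
proof -
  have "has_bochner_integral lborel (\<lambda>w. (0 + y * w) ^ s * exp (- (0 + y * w)) * indicator {0<..} (0 + y * w))
      (fact s /\<^sub>R \<bar>y\<bar>)"
    using has_bochner_integral_I0i_power_exp_m assms
    by (subst lborel_has_bochner_integral_real_affine_iff[symmetric]) auto
  then have "has_bochner_integral lborel
      (\<lambda>w. ((0 + y * w) ^ s * exp (- (0 + y * w)) * indicator {0<..} (0 + y * w)) * (1 / y ^ s))
      ((fact s /\<^sub>R \<bar>y\<bar>) * (1 / y ^ s))"
    by (rule has_bochner_integral_mult_left)
  then show ?thesis
    by (rule has_bochner_integral_cong[THEN iffD1, rotated -1])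
       (use assms in \<open>auto simp: indicator_def power_mult_distrib zero_less_mult_iff field_simps\<close>)
qed

text \<open>The Laplace transform of the sine, from the explicit antiderivative \<open>?F\<close> on
  the half line.\<close>

lemma has_bochner_integral_sin_exp:
  fixes b y :: real
  assumes "0 < y"
  shows "has_bochner_integral lborel (\<lambda>w. indicator {0<..} w * (sin (b * w) * exp (- (y * w)))) (b / (y\<^sup>2 + b\<^sup>2))"
proof -
  let ?f = "\<lambda>w. sin (b * w) * exp (- (y * w))"
  let ?F = "\<lambda>w. - (exp (- (y * w)) * (y * sin (b * w) + b * cos (b * w))) / (y\<^sup>2 + b\<^sup>2)"
  have nz: "y\<^sup>2 + b\<^sup>2 \<noteq> 0" using assms by (simp add: add_nonneg_eq_0_iff)
  have int: "integrable lborel (\<lambda>w. indicator {0<..} w * ?f w)"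
  proof (rule Bochner_Integration.integrable_bound)
    show "integrable lborel (\<lambda>w. indicator {0<..} w * (w ^ 0 * exp (- (y * w))))"
      using has_bochner_integral_power_exp[OF assms, of 0] by (simp add: has_bochner_integral_iff)
    show "AE w in lborel. norm (indicator {0<..} w * ?f w) \<le> norm (indicator {0<..} w * (w ^ 0 * exp (- (y * w))))"
      by (auto simp: indicator_def abs_mult intro!: mult_left_le_one_le)
  qed measurable
  have e0: "((\<lambda>w. exp (- (y * w))) \<longlongrightarrow> 0) at_top"
    using assms by (auto intro!: exp_at_bot[THEN filterlim_compose] filterlim_tendsto_pos_mult_at_top filterlim_ident
             simp: filterlim_uminus_at_bot)
  have "(LBINT w=0..\<infinity>. ?f w) = 0 - (- b / (y\<^sup>2 + b\<^sup>2))"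
  proof (rule interval_integral_FTC_integrable)
    show "(?F has_vector_derivative ?f w) (at w)" for w
    proof -
      have "((\<lambda>w. - (exp (- (y * w)) * (y * sin (b * w) + b * cos (b * w)))) has_real_derivative
          ?f w * (y\<^sup>2 + b\<^sup>2)) (at w)"
        by (auto intro!: derivative_eq_intros simp: algebra_simps power2_eq_square)
      from DERIV_cdivide[OF this, of "y\<^sup>2 + b\<^sup>2"] have "(?F has_real_derivative ?f w) (at w)"
        using assms by simp
      then show ?thesis by (simp add: has_real_derivative_iff_has_vector_derivative)
    qed
    show "set_integrable lborel (einterval 0 \<infinity>) ?f"
      using int by (simp add: set_integrable_def zero_ereal_def)
    show "((?F \<circ> real_of_ereal) \<longlongrightarrow> - b / (y\<^sup>2 + b\<^sup>2)) (at_right 0)"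
      using nz by (auto simp: zero_ereal_def ereal_tendsto_simps intro!: tendsto_eq_intros)
    have "(?F \<longlongrightarrow> 0) at_top"
    proof (rule Lim_null_comparison)
      let ?c = "(\<bar>y\<bar> + \<bar>b\<bar>) / (y\<^sup>2 + b\<^sup>2)"
      show "((\<lambda>w. exp (- (y * w)) * ?c) \<longlongrightarrow> 0) at_top"
        using tendsto_mult_right[OF e0, of ?c] by simp
      have "norm (?F w) \<le> exp (- (y * w)) * ?c" for w
      proof -
        have "\<bar>y * sin (b * w) + b * cos (b * w)\<bar> \<le> \<bar>y\<bar> * \<bar>sin (b * w)\<bar> + \<bar>b\<bar> * \<bar>cos (b * w)\<bar>"
          by (metis abs_mult abs_triangle_ineq)
        also have "\<dots> \<le> \<bar>y\<bar> * 1 + \<bar>b\<bar> * 1"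
          by (intro add_mono mult_left_mono) auto
        finally show ?thesis
          by (simp add: abs_mult divide_right_mono)
      qed
      then show "\<forall>\<^sub>F w in at_top. norm (?F w) \<le> exp (- (y * w)) * ?c" by simp
    qed
    then show "((?F \<circ> real_of_ereal) \<longlongrightarrow> 0) (at_left \<infinity>)"
      unfolding ereal_tendsto_simps .
  qed (auto intro!: continuous_intros)
  then have "integral\<^sup>L lborel (\<lambda>w. indicator {0<..} w * ?f w) = b / (y\<^sup>2 + b\<^sup>2)"
    by (simp add: interval_integral_to_infinity_eq set_lebesgue_integral_def zero_ereal_def)
  with int show ?thesis by (simp add: has_bochner_integral_iff)
qed

text \<open>Termwise Laplace transform at \<open>y = 1 / t\<close>: the sine of frequency
  \<open>b n\<close> contributes exactly the n-th partial fraction of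
  \<open>t / (1 - exp (- t)) - 1 - t / 2\<close>, and the constant 1/2 contributes the missing
  \<open>t / 2\<close>.\<close>

lemma has_bochner_integral_borel_transform_exp:
  fixes y :: real
  assumes y: "0 < y"
  shows "has_bochner_integral lborel (\<lambda>w. indicator {0<..} w * (borel_transform w * exp (- (y * w))))
    ((1 / y) / (1 - exp (- (1 / y))) - 1)"
proof -
  define b where "b n = 1 / (2 * pi * Suc n)" for n :: nat
  let ?g = "\<lambda>n w. (2 * b n) * (indicator {0<..} w * (sin (b n * w) * exp (- (y * w))))"
  have b0: "0 < b n" for n by (simp add: b_def)
  have g_int: "has_bochner_integral lborel (?g n) (2 * b n * (b n / (y\<^sup>2 + (b n)\<^sup>2)))" for n
    by (intro has_bochner_integral_mult_right has_bochner_integral_sin_exp y)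
  \<comment> \<open>Bounding the sine by its argument gains a second factor \<open>b n\<close>; the
    coefficients \<open>b n\<close> alone are not summable.\<close>
  have g_le: "norm (?g n w) \<le> (2 * (b n)\<^sup>2) * (indicator {0<..} w * (w ^ 1 * exp (- (y * w))))" for n w
  proof (cases "0 < w")
    case True
    have "\<bar>sin (b n * w)\<bar> \<le> b n * w"
      using abs_sin_x_le_abs_x[of "b n * w"] True b0[of n] by simp
    then have "2 * b n * (\<bar>sin (b n * w)\<bar> * exp (- (y * w))) \<le> 2 * b n * (b n * w * exp (- (y * w)))"
      using b0[of n] by (intro mult_left_mono mult_right_mono) auto
    then show ?thesis using True b0[of n] by (simp add: abs_mult power2_eq_square mult_ac)
  qed simp
  have b_sum: "summable (\<lambda>n. 2 * (b n)\<^sup>2)"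
  proof -
    have "summable (\<lambda>n. (1 / (2 * pi\<^sup>2)) * (1 / (real (Suc n))\<^sup>2))"
      using sums_summable[OF inverse_squares_sums] by (intro summable_mult) (simp add: add.commute)
    then show ?thesis
      by (rule summable_cong[THEN iffD1, rotated]) (simp add: b_def power_mult_distrib power_divide del: of_nat_Suc)
  qed
  have G1: "AE w in lborel. summable (\<lambda>n. norm (?g n w))"
    by (intro AE_I2 summable_comparison_test'[OF summable_mult2[OF b_sum]]) (use g_le in simp)
  have m1: "has_bochner_integral lborel (\<lambda>w. indicator {0<..} w * (w ^ 1 * exp (- (y * w)))) (fact 1 / y ^ Suc 1)"
    by (rule has_bochner_integral_power_exp[OF y])
  have G2: "summable (\<lambda>n. \<integral>w. norm (?g n w) \<partial>lborel)"
  proof (rule summable_comparison_test')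
    show "summable (\<lambda>n. 2 * (b n)\<^sup>2 * (fact 1 / y ^ Suc 1))"
      by (rule summable_mult2[OF b_sum])
    fix n
    have "(\<integral>w. norm (?g n w) \<partial>lborel) \<le> (\<integral>w. (2 * (b n)\<^sup>2) * (indicator {0<..} w * (w ^ 1 * exp (- (y * w)))) \<partial>lborel)"
      using g_int[of n] m1 g_le by (intro integral_mono integrable_norm integrable_mult_right) (auto simp: has_bochner_integral_iff)
    also have "\<dots> = 2 * (b n)\<^sup>2 * (fact 1 / y ^ Suc 1)"
      using m1 by (simp add: has_bochner_integral_iff)
    finally show "norm (\<integral>w. norm (?g n w) \<partial>lborel) \<le> 2 * (b n)\<^sup>2 * (fact 1 / y ^ Suc 1)"
      by simp
  qed
  have gi: "integrable lborel (?g n)" for n using g_int[of n] by (simp add: has_bochner_integral_iff)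
  have S: "(\<Sum>n. ?g n w) = indicator {0<..} w * ((borel_transform w - 1 / 2) * exp (- (y * w)))" for w
  proof -
    have t: "w / (2 * pi) / Suc n = b n * w" "sin (b n * w) / Suc n = pi * (2 * b n * sin (b n * w))" for n
      by (simp_all add: b_def field_simps del: of_nat_Suc)
    have "(\<lambda>n. sin (w / (2 * pi) / Suc n) / Suc n) sums hardy_littlewood (w / (2 * pi))"
      unfolding hardy_littlewood_def by (rule summable_sums[OF summable_hardy_littlewood])
    then have "(\<lambda>n. pi * (2 * b n * sin (b n * w))) sums hardy_littlewood (w / (2 * pi))"
      unfolding t .
    then have "(\<lambda>n. pi * (2 * b n * sin (b n * w)) / pi) sums (borel_transform w - 1 / 2)"
      unfolding borel_transform_def by (subst add_diff_cancel_left') (rule sums_divide)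
    then have "(\<lambda>n. (2 * b n * sin (b n * w)) * (indicator {0<..} w * exp (- (y * w)))) sums
        ((borel_transform w - 1 / 2) * (indicator {0<..} w * exp (- (y * w))))"
      by (intro sums_mult2) simp
    then show ?thesis by (simp add: sums_iff mult_ac)
  qed
  have "integrable lborel (\<lambda>w. \<Sum>n. ?g n w)"
    by (rule integrable_suminf[OF gi G1 G2])
  moreover have "(\<lambda>n. \<integral>w. ?g n w \<partial>lborel) sums (\<integral>w. (\<Sum>n. ?g n w) \<partial>lborel)"
    by (rule sums_integral[OF gi G1 G2])
  moreover have "(\<integral>w. ?g n w \<partial>lborel) = 2 * (1 / y)\<^sup>2 / ((1 / y)\<^sup>2 + (2 * pi * Suc n)\<^sup>2)" for n
  proof -
    have "(\<integral>w. ?g n w \<partial>lborel) = 2 * b n * (b n / (y\<^sup>2 + (b n)\<^sup>2))"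
      using g_int[of n] by (rule has_bochner_integral_integral_eq)
    also have "\<dots> = 2 * (1 / y)\<^sup>2 / ((1 / y)\<^sup>2 + (1 / b n)\<^sup>2)"
      using b0[of n] y by (simp add: divide_simps power2_eq_square add_nonneg_eq_0_iff)
    finally show ?thesis by (simp add: b_def)
  qed
  ultimately have "has_bochner_integral lborel
      (\<lambda>w. indicator {0<..} w * ((borel_transform w - 1 / 2) * exp (- (y * w))))
      ((1 / y) / (1 - exp (- (1 / y))) - 1 - (1 / y) / 2)"
    using partial_fractions_inverse_one_minus_exp[of "1 / y"] y
    unfolding has_bochner_integral_iff S by (metis (no_types, lifting) sums_cong sums_unique2 zero_less_divide_1_iff)
  from has_bochner_integral_add[OF this has_bochner_integral_mult_right[OF has_bochner_integral_power_exp[OF y, of 0], of "1 / 2"]]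
  show ?thesis
    by (rule has_bochner_integral_cong[THEN iffD1, rotated -1]) (auto simp: algebra_simps)
qed

section \<open>Change of variables in the double integral\<close>

text \<open>For each fixed \<open>w > 0\<close> this is the linear substitution \<open>s\<close> to
  \<open>x * w * s\<close> with Jacobian \<open>x * w\<close>; Fubini with \<open>w\<close>
  outermost assembles the slices.\<close>

lemma scale_integral_pair:
  fixes f :: "real \<times> real \<Rightarrow> real"
  assumes f: "integrable (lborel \<Otimes>\<^sub>M lborel) f" and x: "0 < x"
    and f0: "\<And>s w. w \<le> 0 \<Longrightarrow> f (s, w) = 0"
  defines "g \<equiv> \<lambda>(s, w). indicator {0<..} w * (x * w) * f (x * w * s, w)"
  shows "integrable (lborel \<Otimes>\<^sub>M lborel) g"
    "integral\<^sup>L (lborel \<Otimes>\<^sub>M lborel) g = integral\<^sup>L (lborel \<Otimes>\<^sub>M lborel) f"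
proof -
  have [measurable]: "f \<in> borel_measurable (borel \<Otimes>\<^sub>M borel)"
    using borel_measurable_integrable[OF f] by simp
  have g_meas: "g \<in> borel_measurable (borel \<Otimes>\<^sub>M borel)"
    unfolding g_def by measurable
  note [measurable] = g_meas
  let ?fs = "\<lambda>(w, s). f (s, w)" and ?gs = "\<lambda>(w, s). g (s, w)"
  have fs: "integrable (lborel \<Otimes>\<^sub>M lborel) ?fs"
    using lborel_pair.integrable_product_swap[OF f] .
  \<comment> \<open>The instance \<open>abs\<close> serves integrability and \<open>id\<close> the
    value of the integral.\<close>
  have sc: "(\<integral>s. h (g (s, w)) \<partial>lborel) = (\<integral>s. h (f (s, w)) \<partial>lborel)"
    if h: "h = id \<or> h = abs" for h w
  proof (cases "0 < w")
    case True
    then have c: "x * w \<noteq> 0" using x by simp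
    have "(\<integral>s. h (f (s, w)) \<partial>lborel) = \<bar>x * w\<bar> *\<^sub>R (\<integral>s. h (f (0 + x * w * s, w)) \<partial>lborel)"
      by (rule lborel_integral_real_affine[OF c])
    also have "\<dots> = (\<integral>s. \<bar>x * w\<bar> * h (f (0 + x * w * s, w)) \<partial>lborel)"
      by simp
    also have "\<dots> = (\<integral>s. h (g (s, w)) \<partial>lborel)"
      using h True x by (auto simp: g_def abs_mult)
    finally show ?thesis by simp
  next
    case False
    then show ?thesis using f0[of w] by (simp add: g_def)
  qed
  have gs: "integrable (lborel \<Otimes>\<^sub>M lborel) ?gs"
  proof (rule lborel_pair.Fubini_integrable)
    show "?gs \<in> borel_measurable (lborel \<Otimes>\<^sub>M lborel)" by measurable
    have "integrable lborel (\<lambda>w. \<integral>s. norm (?fs (w, s)) \<partial>lborel)"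
      by (rule lborel_pair.integrable_fst'[OF integrable_norm[OF fs]])
    then show "integrable lborel (\<lambda>w. \<integral>s. norm (?gs (w, s)) \<partial>lborel)"
      using sc[of abs] by simp
    have "AE w in lborel. integrable lborel (\<lambda>s. ?fs (w, s))"
      by (rule lborel_pair.AE_integrable_fst'[OF fs])
    then show "AE w in lborel. integrable lborel (\<lambda>s. ?gs (w, s))"
    proof eventually_elim
      case (elim w)
      show ?case
      proof (cases "0 < w")
        case True
        then have "x * w \<noteq> 0" using x by simp
        then have "integrable lborel (\<lambda>s. f (0 + x * w * s, w))"
          using elim by (intro lborel_integrable_real_affine) auto
        then show ?thesis by (simp add: g_def)
      qed (simp add: g_def)
    qed
  qed
  show gi: "integrable (lborel \<Otimes>\<^sub>M lborel) g"
    using lborel_pair.integrable_product_swap[OF gs] by simp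
  have "integral\<^sup>L (lborel \<Otimes>\<^sub>M lborel) g = (\<integral>w. (\<integral>s. g (s, w) \<partial>lborel) \<partial>lborel)"
    using lborel_pair.integral_snd[of "\<lambda>s w. g (s, w)"] gi by simp
  also have "\<dots> = (\<integral>w. (\<integral>s. f (s, w) \<partial>lborel) \<partial>lborel)"
    using sc[of id] by simp
  also have "\<dots> = integral\<^sup>L (lborel \<Otimes>\<^sub>M lborel) f"
    using lborel_pair.integral_snd[of "\<lambda>s w. f (s, w)"] f by simp
  finally show "integral\<^sup>L (lborel \<Otimes>\<^sub>M lborel) g = integral\<^sup>L (lborel \<Otimes>\<^sub>M lborel) f" .
qed

section \<open>Differentiation under a Laplace-type integral\<close>

text \<open>From \<open>exp (- y) \<ge> 1 - y\<close> follows
  \<open>0 \<le> exp y - 1 - y \<le> y * (exp y - 1)\<close>, which is estimated for each sign of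
  \<open>y\<close>.\<close>

lemma abs_exp_Taylor1_le: "\<bar>exp y - 1 - y\<bar> \<le> y\<^sup>2 * exp \<bar>y\<bar>" for y :: real
proof -
  have 1: "0 \<le> exp y - 1 - y" using exp_ge_add_one_self[of y] by linarith
  have "(1 - y) * exp y \<le> exp (- y) * exp y"
    using exp_ge_add_one_self[of "- y"] by (intro mult_right_mono) (linarith, simp)
  then have 2: "exp y - 1 \<le> y * exp y" by (simp add: algebra_simps flip: exp_add)
  then have 3: "exp y - 1 - y \<le> y * (exp y - 1)" by (simp add: algebra_simps)
  have "y * (exp y - 1) \<le> y\<^sup>2 * exp \<bar>y\<bar>"
  proof (cases "0 \<le> y")
    case True
    then show ?thesis using mult_left_mono[OF 2 True] by (simp add: power2_eq_square mult_ac)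
  next
    case False
    have "y * (exp y - 1) \<le> y * y"
    proof (rule mult_left_mono_neg)
      show "y \<le> exp y - 1" using exp_ge_add_one_self[of y] by linarith
    qed (use False in simp)
    also have "\<dots> \<le> y\<^sup>2 * exp \<bar>y\<bar>"
      using mult_left_mono[of 1 "exp \<bar>y\<bar>" "y * y"] by (simp add: power2_eq_square)
    finally show ?thesis .
  qed
  with 1 3 show ?thesis by simp
qed

context
  fixes M :: "'z measure" and F a :: "'z \<Rightarrow> real"
  assumes meas [measurable]: "F \<in> borel_measurable M" "a \<in> borel_measurable M"
    and nonneg: "\<And>z. F z \<noteq> 0 \<Longrightarrow> 0 \<le> a z"
    and int: "\<And>x. 0 < x \<Longrightarrow> integrable M (\<lambda>z. F z * exp (- (x * a z)))"
begin

text \<open>Half of the exponential decay absorbs one factor, as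
  \<open>a z * exp (- (x / 2 * a z)) \<le> 2 / x\<close>; the induction therefore passes from
  \<open>x\<close> to \<open>x / 2\<close>. The sign of \<open>a\<close> matters only where
  \<open>F\<close> is nonzero, which suits kernels supported on a quadrant.\<close>

lemma integrable_power_exp: "0 < x \<Longrightarrow> integrable M (\<lambda>z. F z * a z ^ k * exp (- (x * a z)))"
proof (induction k arbitrary: x)
  case (Suc k)
  show ?case
  proof (rule Bochner_Integration.integrable_bound)
    show "integrable M (\<lambda>z. (2 / x) * (F z * a z ^ k * exp (- (x / 2 * a z))))"
      using Suc.prems by (intro integrable_mult_right Suc.IH) simp
    have "norm (F z * a z ^ Suc k * exp (- (x * a z))) \<le> norm ((2 / x) * (F z * a z ^ k * exp (- (x / 2 * a z))))" for z
    proof (cases "F z = 0")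
      case False
      define v where "v = x / 2 * a z"
      have v: "0 \<le> v" "a z = (2 / x) * v" using nonneg[OF False] Suc.prems by (simp_all add: v_def)
      have e: "exp (- (x * a z)) = exp (- v) * exp (- v)"
        by (simp add: v_def field_simps flip: exp_add)
      have "v * exp (- v) \<le> exp v * exp (- v)"
        using exp_ge_add_one_self[of v] by (intro mult_right_mono) (linarith, simp)
      then have "v * exp (- v) \<le> 1" by (simp flip: exp_add)
      then have "(2 / x) * (v * exp (- v)) \<le> (2 / x) * 1"
        using Suc.prems by (intro mult_left_mono) auto
      then have "a z * exp (- v) \<le> 2 / x"
        using v(2) by simp
      then have "\<bar>F z\<bar> * a z ^ k * exp (- v) * (a z * exp (- v)) \<le> \<bar>F z\<bar> * a z ^ k * exp (- v) * (2 / x)"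
        using nonneg[OF False] by (intro mult_left_mono) auto
      then show ?thesis
        unfolding e v_def[symmetric] using nonneg[OF False] Suc.prems by (simp add: abs_mult mult_ac)
    qed simp
    then show "AE z in M. norm (F z * a z ^ Suc k * exp (- (x * a z))) \<le> norm ((2 / x) * (F z * a z ^ k * exp (- (x / 2 * a z))))"
      by simp
  qed measurable
qed (simp add: int)

text \<open>For \<open>\<bar>h\<bar> < x / 2\<close> the Taylor remainder of the integrand is at
  most \<open>h ^ 2\<close> times the absolute integrand of order \<open>k + 2\<close> at
  \<open>x / 2\<close>. Its integral \<open>C\<close> is independent of \<open>h\<close>, so the
  difference quotient errs by at most \<open>\<bar>h\<bar> * C\<close>.\<close>

lemma has_real_derivative_integral_power_exp:
  assumes x: "0 < x"
  shows "((\<lambda>x. \<integral>z. F z * a z ^ k * exp (- (x * a z)) \<partial>M) has_real_derivative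
    - (\<integral>z. F z * a z ^ Suc k * exp (- (x * a z)) \<partial>M)) (at x)"
proof -
  define i where "i k x z = F z * a z ^ k * exp (- (x * a z))" for k x z
  define G where "G k x = (\<integral>z. i k x z \<partial>M)" for k x
  have int_i: "integrable M (i k x)" if "0 < x" for k x
    unfolding i_def using that by (rule integrable_power_exp)
  define C where "C = (\<integral>z. \<bar>i (k + 2) (x / 2) z\<bar> \<partial>M)"
  have bound: "\<bar>G k (x + h) - G k x + h * G (Suc k) x\<bar> \<le> h\<^sup>2 * C" if h: "\<bar>h\<bar> < x / 2" for h
  proof -
    have xh: "0 < x + h" using h x by linarith
    have "G k (x + h) - G k x + h * G (Suc k) x = (\<integral>z. i k (x + h) z - i k x z + h * i (Suc k) x z \<partial>M)"
      unfolding G_def using int_i x xh by simp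
    also have "\<bar>\<dots>\<bar> \<le> (\<integral>z. \<bar>i k (x + h) z - i k x z + h * i (Suc k) x z\<bar> \<partial>M)"
      by (rule integral_abs_bound)
    also have "\<dots> \<le> (\<integral>z. h\<^sup>2 * \<bar>i (k + 2) (x / 2) z\<bar> \<partial>M)"
    proof (rule integral_mono)
      show "integrable M (\<lambda>z. \<bar>i k (x + h) z - i k x z + h * i (Suc k) x z\<bar>)"
        using int_i x xh by (intro integrable_abs Bochner_Integration.integrable_add
          Bochner_Integration.integrable_diff integrable_mult_right) auto
      show "integrable M (\<lambda>z. h\<^sup>2 * \<bar>i (k + 2) (x / 2) z\<bar>)"
        using int_i[of "x / 2" "k + 2"] x by (intro integrable_mult_right integrable_abs) auto
      fix z
      show "\<bar>i k (x + h) z - i k x z + h * i (Suc k) x z\<bar> \<le> h\<^sup>2 * \<bar>i (k + 2) (x / 2) z\<bar>"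
      proof (cases "F z = 0")
        case False
        have a0: "0 \<le> a z" using nonneg[OF False] .
        let ?y = "- (h * a z)"
        have "i k (x + h) z - i k x z + h * i (Suc k) x z = i k x z * (exp ?y - 1 - ?y)"
        proof -
          have "exp (- ((x + h) * a z)) = exp (- (x * a z)) * exp ?y"
            by (simp add: algebra_simps flip: exp_add)
          then show ?thesis by (simp add: i_def algebra_simps)
        qed
        then have "\<bar>i k (x + h) z - i k x z + h * i (Suc k) x z\<bar> = \<bar>i k x z\<bar> * \<bar>exp ?y - 1 - ?y\<bar>"
          by (simp only: abs_mult)
        also have "\<dots> \<le> \<bar>i k x z\<bar> * (?y\<^sup>2 * exp \<bar>?y\<bar>)"
          by (intro mult_left_mono abs_exp_Taylor1_le) auto
        also have "\<dots> \<le> \<bar>i k x z\<bar> * (?y\<^sup>2 * exp (x / 2 * a z))"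
        proof -
          have "\<bar>h\<bar> * a z \<le> x / 2 * a z" using h a0 by (intro mult_right_mono) auto
          then show ?thesis using a0 by (intro mult_left_mono) (auto simp: abs_mult)
        qed
        also have "\<dots> = h\<^sup>2 * \<bar>F z * a z ^ (k + 2) * (exp (- (x * a z)) * exp (x / 2 * a z))\<bar>"
          using a0 by (simp add: i_def abs_mult power_mult_distrib power2_eq_square power_add mult_ac)
        also have "exp (- (x * a z)) * exp (x / 2 * a z) = exp (- (x / 2 * a z))"
          by (simp flip: exp_add)
        finally show ?thesis by (simp only: i_def)
      qed (simp add: i_def)
    qed
    finally show ?thesis by (simp add: C_def)
  qed
  have "((\<lambda>h. (G k (x + h) - G k x) / h - (- G (Suc k) x)) \<longlongrightarrow> 0) (at 0)"
  proof (rule Lim_null_comparison)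
    have "\<forall>\<^sub>F h in at 0. \<bar>h\<bar> < x / 2 \<and> h \<noteq> 0"
      unfolding eventually_at using x by (intro exI[of _ "x / 2"]) auto
    then show "\<forall>\<^sub>F h in at 0. norm ((G k (x + h) - G k x) / h - (- G (Suc k) x)) \<le> \<bar>h\<bar> * C"
    proof eventually_elim
      case (elim h)
      then have "(G k (x + h) - G k x) / h - (- G (Suc k) x) = (G k (x + h) - G k x + h * G (Suc k) x) / h"
        by (simp add: field_simps)
      then have "norm ((G k (x + h) - G k x) / h - (- G (Suc k) x)) \<le> (h\<^sup>2 * C) / \<bar>h\<bar>"
        using bound[of h] elim by (simp only: real_norm_def abs_divide) (intro divide_right_mono, auto)
      also have "\<dots> = \<bar>h\<bar> * C" using elim by (simp add: power2_eq_square field_simps abs_if)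
      finally show ?case .
    qed
    show "((\<lambda>h. \<bar>h\<bar> * C) \<longlongrightarrow> 0) (at 0)"
      by (auto intro!: tendsto_eq_intros)
  qed
  then have "((\<lambda>h. (G k (x + h) - G k x) / h) \<longlongrightarrow> - G (Suc k) x) (at 0)"
    by (simp only: LIM_zero_iff)
  then show ?thesis
    unfolding DERIV_def G_def i_def .
qed

end

section \<open>Double integral for Phi and its derivatives\<close>

text \<open>With the factor \<open>exp (- (x * (w / s)))\<close> the integral over \<open>s\<close>
  is \<open>\<phi> w\<close> times the Bessel-type kernel \<kappa>(xw). Keeping it as a double
  integral lets each derivative in \<open>x\<close> just bring down a factor
  \<open>w / s\<close>.\<close>

definition pos_kernel :: "(real \<Rightarrow> real) \<Rightarrow> real \<times> real \<Rightarrow> real" where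
  "pos_kernel \<phi> = (\<lambda>(s, w). indicator {0<..} s * indicator {0<..} w * (\<phi> w * exp (- s)))"

lemma borel_measurable_pos_kernel [measurable]:
  assumes [measurable]: "\<phi> \<in> borel_measurable borel"
  shows "pos_kernel \<phi> \<in> borel_measurable (borel \<Otimes>\<^sub>M borel)"
  unfolding pos_kernel_def by measurable

text \<open>Two Gamma integrals: over \<open>w\<close> first, giving
  \<open>fact j * (s / x) ^ Suc j\<close>, then over \<open>s\<close>. These are the moments of
  \<kappa>(xw).\<close>

lemma pos_kernel_power:
  assumes x: "0 < x"
  shows "integrable (lborel \<Otimes>\<^sub>M lborel) (\<lambda>z. pos_kernel (\<lambda>w. w ^ j) z * exp (- (x * (snd z / fst z))))"
    "(\<integral>z. pos_kernel (\<lambda>w. w ^ j) z * exp (- (x * (snd z / fst z))) \<partial>(lborel \<Otimes>\<^sub>M lborel)) =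
      fact j * fact (Suc j) / x ^ Suc j"
proof -
  let ?f = "\<lambda>z. pos_kernel (\<lambda>w. w ^ j) z * exp (- (x * (snd z / fst z)))"
  have inner: "has_bochner_integral lborel (\<lambda>w. ?f (s, w))
      ((fact j / x ^ Suc j) * (s ^ Suc j * exp (- s) * indicator {0<..} s))" for s
  proof (cases "0 < s")
    case True
    have "has_bochner_integral lborel (\<lambda>w. exp (- s) * (indicator {0<..} w * (w ^ j * exp (- (x / s * w)))))
        (exp (- s) * (fact j / (x / s) ^ Suc j))"
      using x True by (intro has_bochner_integral_mult_right has_bochner_integral_power_exp) auto
    then show ?thesis
      by (rule has_bochner_integral_cong[THEN iffD1, rotated -1])
        (use True in \<open>auto simp: pos_kernel_def power_divide field_simps\<close>)
  qed (simp add: pos_kernel_def has_bochner_integral_zero)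
  have ifn: "?f (s, w) = \<bar>?f (s, w)\<bar>" for s w
    by (auto simp: pos_kernel_def indicator_def)
  have m: "has_bochner_integral lborel (\<lambda>s. (fact j / x ^ Suc j) * (s ^ Suc j * exp (- s) * indicator {0<..} s))
      ((fact j / x ^ Suc j) * fact (Suc j))"
    by (intro has_bochner_integral_mult_right has_bochner_integral_I0i_power_exp_m)
  have ii: "(\<integral>w. ?f (s, w) \<partial>lborel) = (fact j / x ^ Suc j) * (s ^ Suc j * exp (- s) * indicator {0<..} s)" for s
    using inner by (rule has_bochner_integral_integral_eq)
  show int: "integrable (lborel \<Otimes>\<^sub>M lborel) ?f"
  proof (rule lborel_pair.Fubini_integrable)
    show "integrable lborel (\<lambda>s. \<integral>w. norm (?f (s, w)) \<partial>lborel)"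
      unfolding real_norm_def ifn[symmetric] ii using m by (rule integrable.intros)
    show "AE s in lborel. integrable lborel (\<lambda>w. ?f (s, w))"
      using inner by (auto intro: integrable.intros)
  qed measurable
  have "integral\<^sup>L (lborel \<Otimes>\<^sub>M lborel) ?f = (\<integral>s. \<integral>w. ?f (s, w) \<partial>lborel \<partial>lborel)"
    by (rule lborel_pair.integral_fst'[OF int, symmetric])
  also have "\<dots> = (fact j / x ^ Suc j) * fact (Suc j)"
    unfolding ii using m by (rule has_bochner_integral_integral_eq)
  finally show "integral\<^sup>L (lborel \<Otimes>\<^sub>M lborel) ?f = fact j * fact (Suc j) / x ^ Suc j"
    by simp
qed

text \<open>The linear growth of \<open>borel_transform\<close> reduces this to the moments of order
  \<open>m\<close> and \<open>Suc m\<close>.\<close>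

lemma integrable_pos_kernel_borel_transform:
  assumes x: "0 < x"
  shows "integrable (lborel \<Otimes>\<^sub>M lborel)
    (\<lambda>z. pos_kernel (\<lambda>w. borel_transform w * w ^ m) z * exp (- (x * (snd z / fst z))))"
proof (rule Bochner_Integration.integrable_bound)
  let ?p = "\<lambda>j z. pos_kernel (\<lambda>w. w ^ j) z * exp (- (x * (snd z / fst z)))"
  show "integrable (lborel \<Otimes>\<^sub>M lborel) (\<lambda>z. ?p m z + ?p (Suc m) z)"
    by (intro Bochner_Integration.integrable_add pos_kernel_power x)
  have "norm (pos_kernel (\<lambda>w. borel_transform w * w ^ m) (s, w) * exp (- (x * (w / s))))
      \<le> norm (?p m (s, w) + ?p (Suc m) (s, w))" for s w
  proof (cases "0 < s \<and> 0 < w")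
    case True
    have "\<bar>borel_transform w\<bar> * (w ^ m * exp (- s) * exp (- (x * (w / s)))) \<le>
        (1 + w) * (w ^ m * exp (- s) * exp (- (x * (w / s))))"
      using True abs_borel_transform_le[of w] by (intro mult_right_mono) auto
    also have "\<dots> = ?p m (s, w) + ?p (Suc m) (s, w)"
      using True by (simp add: pos_kernel_def algebra_simps)
    also have "\<dots> \<le> \<bar>\<dots>\<bar>" by simp
    finally show ?thesis
      using True by (simp add: pos_kernel_def abs_mult mult_ac)
  qed (auto simp: pos_kernel_def)
  then show "AE z in lborel \<Otimes>\<^sub>M lborel. norm (pos_kernel (\<lambda>w. borel_transform w * w ^ m) z * exp (- (x * (snd z / fst z))))
      \<le> norm (?p m z + ?p (Suc m) z)"
    by auto
qed measurable

lemma deriv_Digamma_eq_Polygamma: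
  fixes x :: real
  assumes "0 < x"
  shows "deriv Digamma x = Polygamma 1 x"
proof -
  have "x \<notin> \<int>\<^sub>\<le>\<^sub>0" using assms by (auto elim!: nonpos_Ints_cases)
  then show ?thesis
    using has_field_derivative_Polygamma[of x 0 UNIV] by (simp add: DERIV_imp_deriv)
qed

text \<open>Each term \<open>x / (x + k) ^ 2\<close> of the trigamma series times \<open>x\<close>
  is a Gamma integral; summing the geometric series inside gives \<open>t / (1 - exp (- t))\<close>
  with \<open>t = s / x\<close>, and the \<open>- 1\<close> is the integral of
  \<open>exp (- s)\<close>.\<close>

lemma has_bochner_integral_Phi:
  assumes x: "0 < x"
  shows "has_bochner_integral lborel
    (\<lambda>s. indicator {0<..} s * (exp (- s) * ((s / x) / (1 - exp (- (s / x))) - 1))) (Phi x)"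
proof -
  let ?g = "\<lambda>k s. (1 / x) * (indicator {0<..} s * (s ^ 1 * exp (- ((1 + real k / x) * s))))"
  have g_int: "has_bochner_integral lborel (?g k) ((1 / x) * (fact 1 / (1 + real k / x) ^ Suc 1))" for k
    using x by (intro has_bochner_integral_mult_right has_bochner_integral_power_exp add_pos_nonneg) auto
  have val: "(1 / x) * (fact 1 / (1 + real k / x) ^ Suc 1) = x * inverse ((x + real k) ^ 2)" for k
  proof -
    have "1 + real k / x = (x + real k) / x" using x by (simp add: field_simps)
    then show ?thesis using x by (simp add: power2_eq_square field_simps)
  qed
  have gi: "integrable lborel (?g k)" for k using g_int[of k] by (rule integrable.intros)
  have gv: "(\<integral>s. ?g k s \<partial>lborel) = x * inverse ((x + real k) ^ 2)" for k
    using has_bochner_integral_integral_eq[OF g_int[of k]] unfolding val .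
  have gn: "norm (?g k s) = ?g k s" for k s
    using x by (auto simp: indicator_def)
  have "(\<lambda>k. inverse ((x + of_nat k) ^ Suc 1)) sums ((-1) ^ Suc 1 * Polygamma 1 x / fact 1)"
    using x by (intro Polygamma_LIMSEQ) auto
  then have P: "(\<lambda>k. x * inverse ((x + real k) ^ 2)) sums (x * Polygamma 1 x)"
    by (intro sums_mult) (simp add: numeral_2_eq_2)
  have S: "(\<lambda>k. ?g k s) sums (indicator {0<..} s * (exp (- s) * ((s / x) / (1 - exp (- (s / x))))))" for s
  proof (cases "0 < s")
    case True
    have "(\<lambda>k. exp (- (s / x)) ^ k) sums (1 / (1 - exp (- (s / x))))"
      using True x by (intro geometric_sums) auto
    from sums_mult[OF this, of "exp (- s) * (s / x)"]
    have "(\<lambda>k. exp (- s) * (s / x) * exp (- (s / x)) ^ k) sums (exp (- s) * ((s / x) / (1 - exp (- (s / x)))))"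
      by simp
    moreover have "exp (- s) * (s / x) * exp (- (s / x)) ^ k = ?g k s" for k
      using True by (simp add: exp_of_nat_mult[symmetric] algebra_simps flip: exp_add)
    ultimately have "(\<lambda>k. ?g k s) sums (exp (- s) * ((s / x) / (1 - exp (- (s / x)))))"
      by (simp only:)
    then show ?thesis using True by simp
  qed simp
  have G1: "AE s in lborel. summable (\<lambda>k. norm (?g k s))"
    unfolding gn using S by (auto simp: sums_iff)
  have G2: "summable (\<lambda>k. \<integral>s. norm (?g k s) \<partial>lborel)"
    unfolding gn gv using P by (simp add: sums_iff)
  have S': "(\<Sum>k. ?g k s) = indicator {0<..} s * (exp (- s) * ((s / x) / (1 - exp (- (s / x)))))" for s
    using S by (simp add: sums_iff)
  have "has_bochner_integral lborel (\<lambda>s. indicator {0<..} s * (exp (- s) * ((s / x) / (1 - exp (- (s / x))))))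
      (x * Polygamma 1 x)"
    using integrable_suminf[OF gi G1 G2] sums_integral[OF gi G1 G2] P
    unfolding has_bochner_integral_iff S' gv by (auto intro: sums_unique2)
  from has_bochner_integral_diff[OF this has_bochner_integral_power_exp[of 1 0]]
  show ?thesis
    by (simp add: Phi_def deriv_Digamma_eq_Polygamma[OF x])
       (rule has_bochner_integral_cong[THEN iffD1, rotated -1], assumption, auto simp: algebra_simps)
qed

text \<open>For fixed \<open>s\<close> the integral over \<open>w\<close> is the Laplace transform
  of \<open>borel_transform\<close> at \<open>x / s\<close>.\<close>

lemma Phi_eq_integral:
  assumes x: "0 < x"
  shows "Phi x = (\<integral>z. pos_kernel borel_transform z * exp (- (x * (snd z / fst z))) \<partial>(lborel \<Otimes>\<^sub>M lborel))"
proof -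
  let ?f = "\<lambda>z. pos_kernel borel_transform z * exp (- (x * (snd z / fst z)))"
  have int: "integrable (lborel \<Otimes>\<^sub>M lborel) ?f"
    using integrable_pos_kernel_borel_transform[OF x, of 0] by simp
  have inner: "(\<integral>w. ?f (s, w) \<partial>lborel) = indicator {0<..} s * (exp (- s) * ((s / x) / (1 - exp (- (s / x))) - 1))" for s
  proof (cases "0 < s")
    case True
    have "has_bochner_integral lborel
        (\<lambda>w. exp (- s) * (indicator {0<..} w * (borel_transform w * exp (- (x / s * w)))))
        (exp (- s) * ((1 / (x / s)) / (1 - exp (- (1 / (x / s)))) - 1))"
      using x True by (intro has_bochner_integral_mult_right has_bochner_integral_borel_transform_exp) auto
    from has_bochner_integral_integral_eq[OF this] show ?thesis
      using True by (simp add: pos_kernel_def mult_ac)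
  qed (simp add: pos_kernel_def)
  have "integral\<^sup>L (lborel \<Otimes>\<^sub>M lborel) ?f = (\<integral>s. \<integral>w. ?f (s, w) \<partial>lborel \<partial>lborel)"
    by (rule lborel_pair.integral_fst'[OF int, symmetric])
  also have "\<dots> = Phi x"
    unfolding inner using has_bochner_integral_Phi[OF x] by (rule has_bochner_integral_integral_eq)
  finally show ?thesis ..
qed

lemma higher_deriv_eq:
  fixes f :: "real \<Rightarrow> real"
  assumes S: "open S" and f: "\<And>x. x \<in> S \<Longrightarrow> f x = G 0 x"
    and G: "\<And>n x. x \<in> S \<Longrightarrow> (G n has_real_derivative G (Suc n) x) (at x)"
    and x: "x \<in> S"
  shows "(deriv ^^ n) f x = G n x"
  using x
proof (induction n arbitrary: x)
  case (Suc n)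
  have "((deriv ^^ n) f has_real_derivative G (Suc n) x) (at x)"
    using has_field_derivative_transform_within_open[OF G[OF Suc.prems] S Suc.prems] Suc.IH by metis
  then show ?case by (simp add: DERIV_imp_deriv)
qed (simp add: f)

lemma higher_deriv_Phi:
  assumes x: "0 < x"
  shows "(deriv ^^ m) Phi x = (-1) ^ m *
    (\<integral>z. pos_kernel borel_transform z * (snd z / fst z) ^ m * exp (- (x * (snd z / fst z))) \<partial>(lborel \<Otimes>\<^sub>M lborel))"
proof (rule higher_deriv_eq[of "{0<..}"])
  fix n and x :: real assume x: "x \<in> {0<..}"
  have "((\<lambda>x. \<integral>z. pos_kernel borel_transform z * (snd z / fst z) ^ n * exp (- (x * (snd z / fst z))) \<partial>(lborel \<Otimes>\<^sub>M lborel))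
      has_real_derivative
      - (\<integral>z. pos_kernel borel_transform z * (snd z / fst z) ^ Suc n * exp (- (x * (snd z / fst z))) \<partial>(lborel \<Otimes>\<^sub>M lborel))) (at x)"
  proof (rule has_real_derivative_integral_power_exp)
    show "integrable (lborel \<Otimes>\<^sub>M lborel) (\<lambda>z. pos_kernel borel_transform z * exp (- (x * (snd z / fst z))))"
      if "0 < x" for x
      using integrable_pos_kernel_borel_transform[OF that, of 0] by simp
    show "0 \<le> snd z / fst z" if "pos_kernel borel_transform z \<noteq> 0" for z
      using that by (auto simp: pos_kernel_def indicator_def split: prod.splits if_splits)
  qed (use x in \<open>auto simp: borel_measurable_pos_kernel\<close>)
  from DERIV_cmult[OF this, of "(-1) ^ n"]
  show "((\<lambda>x. (-1) ^ n * (\<integral>z. pos_kernel borel_transform z * (snd z / fst z) ^ n * exp (- (x * (snd z / fst z))) \<partial>(lborel \<Otimes>\<^sub>M lborel)))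
      has_real_derivative
      (-1) ^ Suc n * (\<integral>z. pos_kernel borel_transform z * (snd z / fst z) ^ Suc n * exp (- (x * (snd z / fst z))) \<partial>(lborel \<Otimes>\<^sub>M lborel))) (at x)"
    by simp
qed (use x in \<open>auto simp: Phi_eq_integral\<close>)

section \<open>The integral after substitution, and its derivatives\<close>

text \<open>The part free of \<open>x\<close> that remains when \<open>s\<close> is replaced by
  \<open>x * w * s\<close>: the two exponentials swap roles, \<open>exp (- s)\<close> becoming
  \<open>exp (- (x * w * s))\<close> and the other one \<open>exp (- (1 / s))\<close>.\<close>

definition dual_kernel :: "nat \<Rightarrow> real \<times> real \<Rightarrow> real" where
  "dual_kernel m = (\<lambda>(s, w). indicator {0<..} s * indicator {0<..} w *
     (borel_transform w * w * (1 / s) ^ m * exp (- (1 / s))))"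

lemma borel_measurable_dual_kernel [measurable]: "dual_kernel m \<in> borel_measurable (borel \<Otimes>\<^sub>M borel)"
  unfolding dual_kernel_def by measurable

text \<open>Up to the sign \<open>(-1) ^ k\<close>, the k-th derivative of the function in the
  theorem with exponent \<open>m - 1\<close>, for positive \<open>m\<close> and
  \<open>x\<close>.\<close>

definition dual_integral :: "nat \<Rightarrow> nat \<Rightarrow> real \<Rightarrow> real" where
  "dual_integral m k x =
    (\<integral>z. dual_kernel m z * (snd z * fst z) ^ k * exp (- (x * (snd z * fst z))) \<partial>(lborel \<Otimes>\<^sub>M lborel))"

text \<open>The Jacobian \<open>x * w\<close> supplies the one power of \<open>x\<close> that
  \<open>x ^ (m - 1)\<close> lacks, and \<open>(w / s) ^ m\<close> turns into
  \<open>(1 / (x * s)) ^ m\<close>, so all powers of \<open>x\<close> cancel.\<close>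

lemma dual_integral_0:
  assumes m: "0 < m" and x: "0 < x"
  shows "integrable (lborel \<Otimes>\<^sub>M lborel) (\<lambda>z. dual_kernel m z * exp (- (x * (snd z * fst z))))"
    "dual_integral m 0 x = (-1) ^ m * x ^ (m - 1) * (deriv ^^ m) Phi x"
proof -
  let ?f = "\<lambda>z. x ^ (m - 1) * (pos_kernel borel_transform z * (snd z / fst z) ^ m * exp (- (x * (snd z / fst z))))"
  let ?g = "\<lambda>(s, w). indicator {0<..} w * (x * w) * ?f (x * w * s, w)"
  have f: "integrable (lborel \<Otimes>\<^sub>M lborel) ?f"
  proof (intro integrable_mult_right integrable_power_exp)
    show "integrable (lborel \<Otimes>\<^sub>M lborel) (\<lambda>z. pos_kernel borel_transform z * exp (- (x * (snd z / fst z))))"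
      if "0 < x" for x
      using integrable_pos_kernel_borel_transform[OF that, of 0] by simp
    show "0 \<le> snd z / fst z" if "pos_kernel borel_transform z \<noteq> 0" for z
      using that by (auto simp: pos_kernel_def indicator_def split: prod.splits if_splits)
  qed (use x in measurable)
  have g: "?g z = dual_kernel m z * exp (- (x * (snd z * fst z)))" for z
  proof (cases z)
    case (Pair s w)
    show ?thesis
    proof (cases "0 < s \<and> 0 < w")
      case True
      have "x ^ m = x * x ^ (m - 1)" using m by (cases m) auto
      moreover have "w / (x * w * s) = 1 / (x * s)" "x * (1 / (x * s)) = 1 / s" using True x by auto
      ultimately show ?thesis
        using True x by (simp add: Pair pos_kernel_def dual_kernel_def power_divide power_mult_distrib mult_ac)
    next
      case False
      moreover have "0 < x * w * s \<longleftrightarrow> 0 < s" if "0 < w"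
        using x that by (metis mult_pos_pos zero_less_mult_pos)
      ultimately show ?thesis by (auto simp: Pair pos_kernel_def dual_kernel_def indicator_def)
    qed
  qed
  have f0: "?f (s, w) = 0" if "w \<le> 0" for s w
    using that by (simp add: pos_kernel_def)
  show "integrable (lborel \<Otimes>\<^sub>M lborel) (\<lambda>z. dual_kernel m z * exp (- (x * (snd z * fst z))))"
    using scale_integral_pair(1)[OF f x f0] unfolding g .
  have "dual_integral m 0 x = integral\<^sup>L (lborel \<Otimes>\<^sub>M lborel) ?f"
    using scale_integral_pair(2)[OF f x f0] unfolding g by (simp add: dual_integral_def)
  then show "dual_integral m 0 x = (-1) ^ m * x ^ (m - 1) * (deriv ^^ m) Phi x"
    unfolding higher_deriv_Phi[OF x] by (simp flip: power_mult_distrib)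
qed

text \<open>After exactly \<open>m\<close> derivatives the factor \<open>(w * s) ^ m\<close> cancels
  \<open>(1 / s) ^ m\<close>. Undoing the substitution then leaves the original kernel with weight
  \<open>w ^ m\<close>.\<close>

lemma dual_integral_self:
  assumes x: "0 < x"
  shows "dual_integral m m x =
    1 / x * (\<integral>z. pos_kernel (\<lambda>w. borel_transform w * w ^ m) z * exp (- (x * (snd z / fst z))) \<partial>(lborel \<Otimes>\<^sub>M lborel))"
proof -
  let ?f = "\<lambda>z. 1 / x * (pos_kernel (\<lambda>w. borel_transform w * w ^ m) z * exp (- (x * (snd z / fst z))))"
  let ?g = "\<lambda>(s, w). indicator {0<..} w * (x * w) * ?f (x * w * s, w)"
  have f: "integrable (lborel \<Otimes>\<^sub>M lborel) ?f"
    by (intro integrable_mult_right integrable_pos_kernel_borel_transform x)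
  have g: "?g z = dual_kernel m z * (snd z * fst z) ^ m * exp (- (x * (snd z * fst z)))" for z
  proof (cases z)
    case (Pair s w)
    show ?thesis
    proof (cases "0 < s \<and> 0 < w")
      case True
      have "w / (x * w * s) = 1 / (x * s)" "x * (1 / (x * s)) = 1 / s" using True x by auto
      then show ?thesis
        using True x by (simp add: Pair pos_kernel_def dual_kernel_def power_divide power_mult_distrib mult_ac)
    next
      case False
      moreover have "0 < x * w * s \<longleftrightarrow> 0 < s" if "0 < w"
        using x that by (metis mult_pos_pos zero_less_mult_pos)
      ultimately show ?thesis by (auto simp: Pair pos_kernel_def dual_kernel_def indicator_def)
    qed
  qed
  have f0: "?f (s, w) = 0" if "w \<le> 0" for s w
    using that by (simp add: pos_kernel_def)
  show ?thesis
    using scale_integral_pair(2)[OF f x f0] unfolding g by (simp add: dual_integral_def)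
qed

lemma has_real_derivative_dual_integral:
  assumes "0 < m" "0 < x"
  shows "((\<lambda>x. (-1) ^ k * dual_integral m k x) has_real_derivative (-1) ^ Suc k * dual_integral m (Suc k) x) (at x)"
proof -
  have "(dual_integral m k has_real_derivative - dual_integral m (Suc k) x) (at x)"
    unfolding dual_integral_def
  proof (rule has_real_derivative_integral_power_exp)
    show "0 \<le> snd z * fst z" if "dual_kernel m z \<noteq> 0" for z
      using that by (auto simp: dual_kernel_def indicator_def split: prod.splits if_splits)
  qed (use assms dual_integral_0(1) in auto)
  from DERIV_cmult[OF this, of "(-1) ^ k"] show ?thesis by simp
qed

text \<open>Under the normalised measure $w^m \kappa(xw)\,dw$ with $x = (m+1)(m+2)/v$ the variable $w$ has mean
  $v$ and variance $2v^2/(m+1)$, so a quadratic majorant of \<open>borel_transform\<close> at $v$ decides the sign.\<close>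

lemma dual_integral_neg:
  assumes v: "0 < v" and c: "borel_transform v = - c" "0 < c" and m: "2 * v\<^sup>2 < c\<^sup>2 * (m + 1)"
  defines "x \<equiv> (real m + 1) * (real m + 2) / v"
  shows "0 < x" "dual_integral m m x < 0"
proof -
  show x: "0 < x" using v by (simp add: x_def)
  \<comment> \<open>Coefficients, in powers of \<open>w\<close>, of the majorant
    \<open>- c / 2 + (w - v) ^ 2 / (2 * c)\<close>.\<close>
  define A where "A = - (c / 2) + v\<^sup>2 / (2 * c)"
  define B where "B = - (v / c)"
  define C where "C = 1 / (2 * c)"
  let ?p = "\<lambda>j z. pos_kernel (\<lambda>w. w ^ j) z * exp (- (x * (snd z / fst z)))"
  let ?L = "lborel \<Otimes>\<^sub>M lborel :: (real \<times> real) measure"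
  define M where "M = fact m * fact (Suc m) / x ^ Suc m"
  have M0: "0 < M" using x by (simp add: M_def)
  have maj: "borel_transform w \<le> A + B * w + C * w\<^sup>2" for w
  proof -
    have "borel_transform w \<le> - c + \<bar>w - v\<bar>"
      using borel_transform_lipschitz[of w v] c by linarith
    \<comment> \<open>The inequality between arithmetic and geometric means replaces the Lipschitz
      cone by a parabola, which only needs two moments.\<close>
    moreover have "\<bar>w - v\<bar> \<le> c / 2 + (w - v)\<^sup>2 / (2 * c)"
    proof -
      have "0 \<le> (c - \<bar>w - v\<bar>)\<^sup>2 / (2 * c)" using c by simp
      also have "\<dots> = c / 2 + (w - v)\<^sup>2 / (2 * c) - \<bar>w - v\<bar>"
        using c by (simp add: power2_diff add_divide_distrib diff_divide_distrib) (simp add: power2_eq_square)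
      finally show ?thesis by simp
    qed
    moreover have "- c + (c / 2 + (w - v)\<^sup>2 / (2 * c)) = A + B * w + C * w\<^sup>2"
      using c by (simp add: A_def B_def C_def power2_diff field_simps)
    ultimately show ?thesis by linarith
  qed
  \<comment> \<open>Consecutive moments have ratio \<open>(j + 1) * (j + 2) / x\<close>; the choice
    of \<open>x\<close> makes the first ratio exactly \<open>v\<close>.\<close>
  have rec: "fact (Suc j) * fact (Suc (Suc j)) / x ^ Suc (Suc j) =
      fact j * fact (Suc j) / x ^ Suc j * ((real j + 1) * (real j + 2) / x)" for j
    using x by (simp add: field_simps)
  have ratio: "(real m + 1) * (real m + 2) / x = v" "(real m + 2) * (real m + 3) / x = v * ((real m + 3) / (real m + 1))"
    using v by (simp_all add: x_def)
  have M1: "(\<integral>z. ?p (Suc m) z \<partial>?L) = M * v"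
    unfolding pos_kernel_power(2)[OF x] M_def rec ratio ..
  have ratio': "(real (Suc m) + 1) * (real (Suc m) + 2) / x = v * ((real m + 3) / (real m + 1))"
    using ratio(2) by (simp add: add.commute)
  have M2: "(\<integral>z. ?p (Suc (Suc m)) z \<partial>?L) = M * v\<^sup>2 * ((real m + 3) / (real m + 1))"
    unfolding pos_kernel_power(2)[OF x] M_def rec ratio ratio' by (simp only: power2_eq_square mult.assoc)
  have "(\<integral>z. pos_kernel (\<lambda>w. borel_transform w * w ^ m) z * exp (- (x * (snd z / fst z))) \<partial>?L)
      \<le> (\<integral>z. A * ?p m z + B * ?p (Suc m) z + C * ?p (Suc (Suc m)) z \<partial>?L)"
  proof (rule integral_mono)
    show "integrable ?L (\<lambda>z. pos_kernel (\<lambda>w. borel_transform w * w ^ m) z * exp (- (x * (snd z / fst z))))"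
      by (rule integrable_pos_kernel_borel_transform[OF x])
    show "integrable ?L (\<lambda>z. A * ?p m z + B * ?p (Suc m) z + C * ?p (Suc (Suc m)) z)"
      by (intro Bochner_Integration.integrable_add integrable_mult_right pos_kernel_power x)
    fix z :: "real \<times> real"
    obtain s w where z: "z = (s, w)" by force
    show "pos_kernel (\<lambda>w. borel_transform w * w ^ m) z * exp (- (x * (snd z / fst z)))
        \<le> A * ?p m z + B * ?p (Suc m) z + C * ?p (Suc (Suc m)) z"
    proof (cases "0 < s \<and> 0 < w")
      case True
      have "borel_transform w * (w ^ m * exp (- s) * exp (- (x * (w / s))))
          \<le> (A + B * w + C * w\<^sup>2) * (w ^ m * exp (- s) * exp (- (x * (w / s))))"
        using True by (intro mult_right_mono maj) auto
      then show ?thesis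
        using True by (simp add: z pos_kernel_def algebra_simps power2_eq_square)
    qed (auto simp: z pos_kernel_def)
  qed
  also have "\<dots> = A * M + B * (M * v) + C * (M * v\<^sup>2 * ((real m + 3) / (real m + 1)))"
  proof -
    define P where "P j z = ?p j z" for j z
    have "integrable ?L (P j)" for j
      unfolding P_def by (rule pos_kernel_power(1)[OF x])
    then have "(\<integral>z. A * P m z + B * P (Suc m) z + C * P (Suc (Suc m)) z \<partial>?L) =
        A * (\<integral>z. P m z \<partial>?L) + B * (\<integral>z. P (Suc m) z \<partial>?L) + C * (\<integral>z. P (Suc (Suc m)) z \<partial>?L)"
      by simp
    then show ?thesis
      unfolding P_def M1 M2 pos_kernel_power(2)[OF x] M_def[symmetric] .
  qed
  also have "\<dots> = M * (A + B * v + C * v\<^sup>2 * (1 + 2 / (real m + 1)))"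
  proof -
    have "(real m + 3) / (real m + 1) = 1 + 2 / (real m + 1)" by (simp add: field_simps)
    then show ?thesis by (simp add: algebra_simps)
  qed
  \<comment> \<open>The majorant averages to \<open>- c / 2\<close> plus the variance
    \<open>2 * v ^ 2 / (m + 1)\<close> divided by \<open>2 * c\<close>; the hypothesis on
    \<open>m\<close> makes this negative.\<close>
  also have "A + B * v + C * v\<^sup>2 * (1 + 2 / (real m + 1)) = v\<^sup>2 / (c * (real m + 1)) - c / 2"
  proof -
    define t where "t = 1 / (real m + 1)"
    have t: "2 / (real m + 1) = 2 * t" "v\<^sup>2 / (c * (real m + 1)) = v\<^sup>2 / c * t"
      by (simp_all add: t_def)
    show ?thesis
      unfolding t using c by (simp add: A_def B_def C_def power2_eq_square field_simps)
  qed
  also have "M * (v\<^sup>2 / (c * (real m + 1)) - c / 2) < 0"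
  proof -
    have "v\<^sup>2 / (c * (real m + 1)) < c / 2"
      using c m by (subst pos_divide_less_eq) (auto simp: power2_eq_square mult_ac add_ac)
    then show ?thesis using M0 by (simp add: mult_pos_neg)
  qed
  finally show "dual_integral m m x < 0"
    unfolding dual_integral_self[OF x] using x by (simp add: divide_neg_pos)
qed

section \<open>Consequences for complete monotonicity\<close>

text \<open>By Leibniz the n-th derivative of \<open>x * G 0 x\<close> is
  \<open>x * G n x + n * G (n - 1) x\<close>. In the alternating sign pattern the second term is
  nonpositive by induction, so the first must be nonnegative. This reduces the exponent
  \<open>m\<close> to \<open>m - 1\<close>.\<close>

lemma completely_monotonic_on_times_id:
  assumes cm: "completely_monotonic_on {0<..} (\<lambda>x. x * G 0 x)"
    and G: "\<And>n x. 0 < x \<Longrightarrow> (G n has_real_derivative G (Suc n) x) (at x)"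
    and x: "0 < x"
  shows "0 \<le> (-1) ^ n * G n x"
proof -
  \<comment> \<open>At \<open>n = 0\<close> the truncated index \<open>n - 1\<close> is harmless
    because of the factor \<open>n\<close>.\<close>
  define H where "H n x = x * G n x + n * G (n - 1) x" for n x
  have H: "(deriv ^^ n) (\<lambda>x. x * G 0 x) x = H n x" for n
  proof (rule higher_deriv_eq[of "{0<..}"])
    fix n and x :: real assume "x \<in> {0<..}"
    then show "(H n has_real_derivative H (Suc n) x) (at x)"
      unfolding H_def[abs_def] by (cases n) (auto intro!: derivative_eq_intros G simp: algebra_simps)
  qed (use x in \<open>auto simp: H_def\<close>)
  have pos: "0 \<le> (-1) ^ n * H n x" for n
    using cm x by (auto simp: completely_monotonic_on_open_iff simp flip: H)
  show ?thesis
  proof (induction n)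
    case 0
    show ?case using pos[of 0] x by (simp add: H_def zero_le_mult_iff)
  next
    case (Suc n)
    have "0 \<le> x * ((-1) ^ Suc n * G (Suc n) x) - Suc n * ((-1) ^ n * G n x)"
      using pos[of "Suc n"] by (simp add: H_def algebra_simps)
    moreover have "0 \<le> Suc n * ((-1) ^ n * G n x)"
      by (rule mult_nonneg_nonneg[OF of_nat_0_le_iff Suc])
    ultimately have "0 \<le> x * ((-1) ^ Suc n * G (Suc n) x)" by linarith
    then show ?case using x by (meson mult_pos_neg not_le)
  qed
qed

lemma completely_monotonic_on_derivs:
  assumes cm: "completely_monotonic_on {0<..} (G 0)"
    and G: "\<And>n x. 0 < x \<Longrightarrow> (G n has_real_derivative G (Suc n) x) (at x)"
    and x: "0 < x"
  shows "0 \<le> (-1) ^ n * G n x"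
proof -
  have "(deriv ^^ n) (G 0) x = G n x"
    by (rule higher_deriv_eq[of "{0<..}"]) (use x G in auto)
  moreover have "0 \<le> (-1) ^ n * (deriv ^^ n) (G 0) x"
    using cm x by (simp add: completely_monotonic_on_open_iff)
  ultimately show ?thesis by simp
qed

lemma completely_monotonic_on_cong:
  "(\<And>x. x \<in> I \<Longrightarrow> f x = g x) \<Longrightarrow> completely_monotonic_on I f \<longleftrightarrow> completely_monotonic_on I g"
  unfolding completely_monotonic_on_def by simp

theorem proposition1p2:
  shows "\<exists>m\<^sub>0::nat. 1 \<le> m\<^sub>0 \<and>
    (\<forall>m\<ge>m\<^sub>0. \<forall>\<alpha>\<in>{m, m - 1}.
       \<not> completely_monotonic_on {0<..} (\<lambda>x. (-1) ^ m * x ^ \<alpha> * (deriv ^^ m) Phi x))"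
proof -
  obtain u where u: "0 < u" "hardy_littlewood u < - (pi / 2)"
    using ex_hardy_littlewood_less by blast
  \<comment> \<open>The factor \<open>2 * pi\<close> undoes the scaling in
    \<open>borel_transform\<close>, so that its value at \<open>v\<close> is negative.\<close>
  define v where "v = 2 * pi * u"
  define c where "c = - borel_transform v"
  have v: "0 < v" using u by (simp add: v_def)
  have c: "0 < c" "borel_transform v = - c"
    using u by (simp_all add: c_def borel_transform_def v_def field_simps)
  \<comment> \<open>Large enough that every \<open>m > k\<close> satisfies
    \<open>2 * v ^ 2 < c ^ 2 * (m + 1)\<close>; the threshold \<open>Suc k\<close> also keeps
    \<open>m\<close> positive.\<close>
  define k where "k = nat \<lceil>2 * v\<^sup>2 / c\<^sup>2\<rceil>"
  have "\<not> completely_monotonic_on {0<..} (\<lambda>x. (-1) ^ m * x ^ \<alpha> * (deriv ^^ m) Phi x)"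
    if m: "Suc k \<le> m" and \<alpha>: "\<alpha> \<in> {m, m - 1}" for m \<alpha>
  proof
    assume cm: "completely_monotonic_on {0<..} (\<lambda>x. (-1) ^ m * x ^ \<alpha> * (deriv ^^ m) Phi x)"
    define G where "G n x = (-1) ^ n * dual_integral m n x" for n x
    have m0: "0 < m" using m by simp
    have G: "(G n has_real_derivative G (Suc n) x) (at x)" if "0 < x" for n x
      unfolding G_def[abs_def] by (rule has_real_derivative_dual_integral[OF m0 that])
    have G0: "G 0 x = (-1) ^ m * x ^ (m - 1) * (deriv ^^ m) Phi x" if "0 < x" for x
      using dual_integral_0(2)[OF m0 that] by (simp add: G_def)
    have nonneg: "0 \<le> dual_integral m m x" if x: "0 < x" for x
    proof -
      have "0 \<le> (-1) ^ m * G m x"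
      proof (cases "\<alpha> = m")
        case True
        have "completely_monotonic_on {0<..} (\<lambda>x. x * G 0 x)"
        proof (rule completely_monotonic_on_cong[THEN iffD1, OF _ cm])
          fix x :: real assume "x \<in> {0<..}"
          then show "(-1) ^ m * x ^ \<alpha> * (deriv ^^ m) Phi x = x * G 0 x"
            using m0 True by (simp add: G0 power_eq_if)
        qed
        then show ?thesis using G x by (rule completely_monotonic_on_times_id)
      next
        case False
        have "completely_monotonic_on {0<..} (G 0)"
          by (rule completely_monotonic_on_cong[THEN iffD1, OF _ cm]) (use False \<alpha> G0 in auto)
        then show ?thesis using G x by (rule completely_monotonic_on_derivs)
      qed
      then show ?thesis by (simp add: G_def flip: mult.assoc power_mult_distrib)
    qed
    have "2 * v\<^sup>2 / c\<^sup>2 \<le> k" unfolding k_def by linarith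
    also have "\<dots> < m + 1" using m by simp
    finally have "2 * v\<^sup>2 < c\<^sup>2 * (m + 1)" using c by (simp add: field_simps)
    from dual_integral_neg[OF v c(2,1) this] nonneg show False by fastforce
  qed
  then show ?thesis by (intro exI[of _ "Suc k"]) auto
qed

end
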